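(* Let $\mathcal C$ be a triangulated category with shift functor $[1]$ and with Auslander–Reiten translation $\tau$, and let $\mathcal X$ be a functorially finite subcategory of $\mathcal C$ which satisfies $\tau\mathcal X=\mathcal X$. Then the following statements hold. (1) Let $A\xrightarrow{f}B\xrightarrow{g}C\to A[1]$ be a triangle in $\mathcal C$. Then $f$ is $\mathcal X$-monic if and only if $g$ is $\mathcal X$-epic. (2) For $A,C\in\mathcal C$ let $\mathbb E'(C,A)\subseteq\mathcal C(C,A[1])$ be the collection of those $\delta$ for which, in a triangle $A\xrightarrow{f}B\xrightarrow{g}C\xrightarrow{\delta}A[1]$, the morphism $f$ is $\mathcal X$-monic, and for $\delta\in\mathbb E'(C,A)$ put $\mathfrak s'(\delta)=[A\xrightarrow{f}B\xrightarrow{g}C]$. Then $(\mathcal C,\mathbb E',\mathfrak s')$ is a Frobenius extriangulated category whose projective objects are precisely the objects of $\mathcal X$.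
   Context: Conventions: $k$ is a field; all categories are Krull–Schmidt $k$-linear categories; all subcategories are full and closed under isomorphisms, direct sums and direct summands. Source morphism $f:A\to B$: $f$ is not a section, every $u:A\to C$ that is not a section factors through $f$, and $\phi f=f$ implies $\phi$ is an automorphism; sink morphisms are dual. An Auslander–Reiten triangle is a triangle $A\xrightarrow{f}B\xrightarrow{g}C\to A[1]$ with $f$ a source and $g$ a sink morphism; then $A,C$ are indecomposable and one writes $A=\tau C$, $C=\tau^{-1}A$. "With Auslander–Reiten translation $\tau$" means every indecomposable object is the end term and the starting term of Auslander–Reiten triangles; $\tau$ is extended additively to all objects. A left $\mathcal X$-approximation of $A$ is a morphism $A\to X$ with $X\in\mathcal X$ through which every morphism from $A$ to an object of $\mathcal X$ factors; right $\mathcal X$-approximations are dual. $\mathcal X$ is functorially finite if every object of $\mathcal C$ has both a left and a right $\mathcal X$-approximation. A morphism $f:A\to B$ is $\mathcal X$-monic if $\mathcal C(f,X):\mathcal C(B,X)\to\mathcal C(A,X)$ is surjective for all $X\in\mathcal X$; $g:C\to D$ is $\mathcal X$-epic if $\mathcal C(X,g):\mathcal C(X,C)\to\mathcal C(X,D)$ is surjective for all $X\in\mathcal X$. Extriangulated category $(\mathcal C,\mathbb E,\mathfrak s)$ (Nakaoka–Palu): $\mathcal C$ is an additive category. (ET1) $\mathbb E:\mathcal C^{op}\times\mathcal C\to\mathrm{Ab}$ is a biadditive functor; elements $\delta\in\mathbb E(C,A)$ are called $\mathbb E$-extensions; for $a:A\to A'$, $c:C'\to C$ write $a_*\delta=\mathbb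 E(C,a)(\delta)$, $c^*\delta=\mathbb E(c,A)(\delta)$. A morphism $(a,c):\delta\to\delta'$ from $\delta\in\mathbb E(C,A)$ to $\delta'\in\mathbb E(C',A')$ is a pair $a:A\to A'$, $c:C\to C'$ with $a_*\delta=c^*\delta'$. (ET2) $\mathfrak s$ is an additive realization: it assigns to each $\delta\in\mathbb E(C,A)$ an equivalence class $\mathfrak s(\delta)=[A\xrightarrow{x}B\xrightarrow{y}C]$ of sequences ($A\to B\to C$ and $A\to B'\to C$ are equivalent if there is an isomorphism $B\to B'$ compatible with $\mathrm{id}_A,\mathrm{id}_C$), such that every morphism $(a,c):\delta\to\delta'$ is realized by some $b:B\to B'$ with $bx=x'a$, $y'b=cy$ (where $\mathfrak s(\delta')=[A'\xrightarrow{x'}B'\xrightarrow{y'}C']$), $\mathfrak s(0)=[A\to A\oplus C\to C]$, and $\mathfrak s(\delta\oplus\delta')=\mathfrak s(\delta)\oplus\mathfrak s(\delta')$. (ET3) If $\delta,\delta'$ are realized by $A\xrightarrow{x}B\xrightarrow{y}C$ and $A'\xrightarrow{x'}B'\xrightarrow{y'}C'$ and $bx=x'a$, then there is $c$ with $(a,c):\delta\to\delta'$ a morphism and $cy=y'b$. (ET3)$^{op}$ Dually, if $cy=y'b$ then there is $a$ with $(a,c):\delta\to\delta'$ a morphism and $bx=x'a$. (ET4) If $\delta\in\mathbb E(D,A)$ is realized by $A\xrightarrow{f}B\xrightarrow{f'}D$ and $\delta'\in\mathbb E(F,B)$ by $B\xrightarrow{g}C\xrightarrow{g'}F$, then there are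 an object $E$, morphisms $h':C\to E$, $d:D\to E$, $e:E\to F$ with $h'g=df'$, $eh'=g'$, and $\delta''\in\mathbb E(E,A)$ realized by $A\xrightarrow{gf}C\xrightarrow{h'}E$ such that $D\xrightarrow{d}E\xrightarrow{e}F$ realizes $f'_*\delta'$, $d^*\delta''=\delta$ and $f_*\delta''=e^*\delta'$. (ET4)$^{op}$ If $\delta\in\mathbb E(B,D)$ is realized by $D\xrightarrow{f'}A\xrightarrow{f}B$ and $\delta'\in\mathbb E(C,F)$ by $F\xrightarrow{g'}B\xrightarrow{g}C$, then there are an object $E$, morphisms $d:D\to E$, $e:E\to F$, $h':E\to A$ with $h'd=f'$, $fh'=g'e$, and $\delta''\in\mathbb E(C,E)$ realized by $E\xrightarrow{h'}A\xrightarrow{gf}C$ such that $D\xrightarrow{d}E\xrightarrow{e}F$ realizes $g'^*\delta$, $e_*\delta''=\delta'$ and $d_*\delta=g^*\delta''$. If $A\xrightarrow{x}B\xrightarrow{y}C$ realizes $\delta$, it is called (together with $\delta$) an $\mathbb E$-triangle. In the claim, $\mathbb E'$ carries the functoriality and addition inherited from $\mathcal C(-,-[1])$; that these are well defined on $\mathbb E'$ is part of the assertion. In an extriangulated category an object $P$ is projective if for every $\mathbb E$-triangle $A\to B\xrightarrow{y}C\dashrightarrow$ every morphism $P\to C$ factors through $y$; injectives are dual. It has enough projectives if each object $C$ admits an $\mathbb E$-triangle $A\to P\to C\dashrightarrow$ with $P$ projective; enough injectives is dual. It is Frobenius if it has enough projectives and enough injectives and the projectives coincide with the injectives. *)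

theory Defs
  imports "HOL-Algebra.Module"
begin

section \<open>Additive, linear and Krull-Schmidt categories\<close>

text \<open>
  The type \<open>'o\<close> is the class of objects. \<open>Hom \<C> A B\<close> is a module record, so that it
  carries the addition and the scalar multiplication of morphisms; morphisms are composed in the
  usual order, i.e. \<open>g \<cdot> f\<close> is \<open>f\<close> followed by \<open>g\<close>. Since nothing forces the hom-sets to be
  disjoint, all properties of morphisms below mention source and target explicitly.
\<close>

record ('k, 'o, 'm) category =
  Hom :: "'o \<Rightarrow> 'o \<Rightarrow> ('k, 'm) module"
  Comp :: "'m \<Rightarrow> 'm \<Rightarrow> 'm"  (infixr "\<cdot>\<index>" 75)
  ident :: "'o \<Rightarrow> 'm"

abbreviation mor :: "('k, 'o, 'm, 'x) category_scheme \<Rightarrow> 'o \<Rightarrow> 'o \<Rightarrow> 'm set" where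
  "mor \<C> A B \<equiv> carrier (Hom \<C> A B)"

context
  fixes \<C> :: "('k, 'o, 'm, 'x) category_scheme" (structure)
begin

definition is_section :: "'o \<Rightarrow> 'o \<Rightarrow> 'm \<Rightarrow> bool" where
  "is_section A B f \<longleftrightarrow> f \<in> mor \<C> A B \<and> (\<exists>r\<in>mor \<C> B A. r \<cdot> f = ident \<C> A)"

definition is_retraction :: "'o \<Rightarrow> 'o \<Rightarrow> 'm \<Rightarrow> bool" where
  "is_retraction A B f \<longleftrightarrow> f \<in> mor \<C> A B \<and> (\<exists>s\<in>mor \<C> B A. f \<cdot> s = ident \<C> B)"

definition is_iso :: "'o \<Rightarrow> 'o \<Rightarrow> 'm \<Rightarrow> bool" where
  "is_iso A B f \<longleftrightarrow> f \<in> mor \<C> A B \<and>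
     (\<exists>g\<in>mor \<C> B A. g \<cdot> f = ident \<C> A \<and> f \<cdot> g = ident \<C> B)"

definition isomorphic :: "'o \<Rightarrow> 'o \<Rightarrow> bool" where
  "isomorphic A B \<longleftrightarrow> (\<exists>f. is_iso A B f)"

definition zero_object :: "'o \<Rightarrow> bool" where
  "zero_object Z \<longleftrightarrow>
     (\<forall>A. mor \<C> A Z = {\<zero>\<^bsub>Hom \<C> A Z\<^esub>} \<and> mor \<C> Z A = {\<zero>\<^bsub>Hom \<C> Z A\<^esub>})"

text \<open>\<open>S\<close> is \<open>A \<oplus> B\<close> with injections \<open>i\<close>, \<open>j\<close> and projections \<open>p\<close>, \<open>q\<close>.\<close>

definition biproduct :: "'o \<Rightarrow> 'o \<Rightarrow> 'o \<Rightarrow> 'm \<Rightarrow> 'm \<Rightarrow> 'm \<Rightarrow> 'm \<Rightarrow> bool" where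
  "biproduct A B S i j p q \<longleftrightarrow>
     i \<in> mor \<C> A S \<and> j \<in> mor \<C> B S \<and> p \<in> mor \<C> S A \<and> q \<in> mor \<C> S B \<and>
     p \<cdot> i = ident \<C> A \<and> q \<cdot> j = ident \<C> B \<and>
     p \<cdot> j = \<zero>\<^bsub>Hom \<C> B A\<^esub> \<and> q \<cdot> i = \<zero>\<^bsub>Hom \<C> A B\<^esub> \<and>
     i \<cdot> p \<oplus>\<^bsub>Hom \<C> S S\<^esub> j \<cdot> q = ident \<C> S"

text \<open>\<open>S\<close> is a direct sum of \<open>X 0, \<dots>, X (n - 1)\<close>; for \<open>n = 0\<close> this says that \<open>S\<close> is zero.\<close>

definition direct_sum :: "nat \<Rightarrow> (nat \<Rightarrow> 'o) \<Rightarrow> 'o \<Rightarrow> bool" where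
  "direct_sum n X S \<longleftrightarrow> (\<exists>i p.
     (\<forall>a<n. i a \<in> mor \<C> (X a) S \<and> p a \<in> mor \<C> S (X a)) \<and>
     (\<forall>a<n. \<forall>b<n. p b \<cdot> i a =
        (if a = b then ident \<C> (X a) else \<zero>\<^bsub>Hom \<C> (X a) (X b)\<^esub>)) \<and>
     (\<Oplus>\<^bsub>Hom \<C> S S\<^esub>a\<in>{..<n}. i a \<cdot> p a) = ident \<C> S)"

definition indecomposable :: "'o \<Rightarrow> bool" where
  "indecomposable M \<longleftrightarrow> \<not> zero_object M \<and>
     (\<forall>A B i j p q. biproduct A B M i j p q \<longrightarrow> zero_object A \<or> zero_object B)"

definition End_ring :: "'o \<Rightarrow> 'm ring" where
  "End_ring A = \<lparr>carrier = mor \<C> A A, mult = Comp \<C>, one = ident \<C> A,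
     zero = \<zero>\<^bsub>Hom \<C> A A\<^esub>, add = add (Hom \<C> A A)\<rparr>"

end

text \<open>Local rings are not assumed to be commutative.\<close>

definition local_ring :: "('a, 'b) ring_scheme \<Rightarrow> bool" where
  "local_ring R \<longleftrightarrow> ring R \<and> \<one>\<^bsub>R\<^esub> \<noteq> \<zero>\<^bsub>R\<^esub> \<and>
     (\<forall>a\<in>carrier R - Units R. \<forall>b\<in>carrier R - Units R. a \<oplus>\<^bsub>R\<^esub> b \<notin> Units R)"

definition krull_schmidt :: "('k, 'o, 'm, 'x) category_scheme \<Rightarrow> bool" where
  "krull_schmidt \<C> \<longleftrightarrow>
     (\<forall>A. \<exists>n X. direct_sum \<C> n X A \<and> (\<forall>a<n. local_ring (End_ring \<C> (X a))))"

locale additive_category =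
  fixes \<C> :: "('k, 'o, 'm, 'x) category_scheme" (structure)
  assumes Hom_group: "abelian_group (Hom \<C> A B)"
    and ident_mor: "ident \<C> A \<in> mor \<C> A A"
    and comp_mor: "\<lbrakk>f \<in> mor \<C> A B; g \<in> mor \<C> B C\<rbrakk> \<Longrightarrow> g \<cdot> f \<in> mor \<C> A C"
    and comp_assoc: "\<lbrakk>f \<in> mor \<C> A B; g \<in> mor \<C> B C; h \<in> mor \<C> C D\<rbrakk>
      \<Longrightarrow> (h \<cdot> g) \<cdot> f = h \<cdot> (g \<cdot> f)"
    and ident_comp: "f \<in> mor \<C> A B \<Longrightarrow> ident \<C> B \<cdot> f = f"
    and comp_ident: "f \<in> mor \<C> A B \<Longrightarrow> f \<cdot> ident \<C> A = f"
    and comp_add: "\<lbrakk>f \<in> mor \<C> A B; f' \<in> mor \<C> A B; g \<in> mor \<C> B C\<rbrakk>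
      \<Longrightarrow> g \<cdot> (f \<oplus>\<^bsub>Hom \<C> A B\<^esub> f') = g \<cdot> f \<oplus>\<^bsub>Hom \<C> A C\<^esub> g \<cdot> f'"
    and add_comp: "\<lbrakk>f \<in> mor \<C> A B; g \<in> mor \<C> B C; g' \<in> mor \<C> B C\<rbrakk>
      \<Longrightarrow> (g \<oplus>\<^bsub>Hom \<C> B C\<^esub> g') \<cdot> f = g \<cdot> f \<oplus>\<^bsub>Hom \<C> A C\<^esub> g' \<cdot> f"
    and zero_object_exists: "\<exists>Z. zero_object \<C> Z"
    and biproduct_exists: "\<exists>S i j p q. biproduct \<C> A B S i j p q"

locale linear_category = additive_category \<C>
  for \<C> :: "('k, 'o, 'm, 'x) category_scheme" (structure) +
  fixes K :: "('k, 'y) ring_scheme"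
  assumes base_field: "field K"
    and Hom_module: "module K (Hom \<C> A B)"
    and comp_smult: "\<lbrakk>c \<in> carrier K; f \<in> mor \<C> A B; g \<in> mor \<C> B C\<rbrakk>
      \<Longrightarrow> g \<cdot> (c \<odot>\<^bsub>Hom \<C> A B\<^esub> f) = c \<odot>\<^bsub>Hom \<C> A C\<^esub> (g \<cdot> f)"
    and smult_comp: "\<lbrakk>c \<in> carrier K; f \<in> mor \<C> A B; g \<in> mor \<C> B C\<rbrakk>
      \<Longrightarrow> (c \<odot>\<^bsub>Hom \<C> B C\<^esub> g) \<cdot> f = c \<odot>\<^bsub>Hom \<C> A C\<^esub> (g \<cdot> f)"


section \<open>Subcategories and approximations\<close>

text \<open>A full subcategory is given by its set of objects.\<close>

context
  fixes \<C> :: "('k, 'o, 'm, 'x) category_scheme" (structure)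
begin

definition closed_subcategory :: "'o set \<Rightarrow> bool" where
  "closed_subcategory \<X> \<longleftrightarrow>
     (\<forall>A B. A \<in> \<X> \<and> isomorphic \<C> A B \<longrightarrow> B \<in> \<X>) \<and>
     (\<forall>n X S. direct_sum \<C> n X S \<and> (\<forall>a<n. X a \<in> \<X>) \<longrightarrow> S \<in> \<X>) \<and>
     (\<forall>n X S. direct_sum \<C> n X S \<and> S \<in> \<X> \<longrightarrow> (\<forall>a<n. X a \<in> \<X>))"

definition left_approximation :: "'o set \<Rightarrow> 'o \<Rightarrow> 'o \<Rightarrow> 'm \<Rightarrow> bool" where
  "left_approximation \<X> A X f \<longleftrightarrow> X \<in> \<X> \<and> f \<in> mor \<C> A X \<and>
     (\<forall>Y\<in>\<X>. \<forall>u\<in>mor \<C> A Y. \<exists>v\<in>mor \<C> X Y. u = v \<cdot> f)"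

definition right_approximation :: "'o set \<Rightarrow> 'o \<Rightarrow> 'o \<Rightarrow> 'm \<Rightarrow> bool" where
  "right_approximation \<X> A X f \<longleftrightarrow> X \<in> \<X> \<and> f \<in> mor \<C> X A \<and>
     (\<forall>Y\<in>\<X>. \<forall>u\<in>mor \<C> Y A. \<exists>v\<in>mor \<C> Y X. u = f \<cdot> v)"

definition functorially_finite :: "'o set \<Rightarrow> bool" where
  "functorially_finite \<X> \<longleftrightarrow>
     (\<forall>A. (\<exists>X f. left_approximation \<X> A X f) \<and> (\<exists>X f. right_approximation \<X> A X f))"

definition monic_wrt :: "'o set \<Rightarrow> 'o \<Rightarrow> 'o \<Rightarrow> 'm \<Rightarrow> bool" where
  "monic_wrt \<X> A B f \<longleftrightarrow> f \<in> mor \<C> A B \<and>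
     (\<forall>X\<in>\<X>. (\<lambda>u. u \<cdot> f) ` mor \<C> B X = mor \<C> A X)"

definition epic_wrt :: "'o set \<Rightarrow> 'o \<Rightarrow> 'o \<Rightarrow> 'm \<Rightarrow> bool" where
  "epic_wrt \<X> A B g \<longleftrightarrow> g \<in> mor \<C> A B \<and>
     (\<forall>X\<in>\<X>. (\<lambda>u. g \<cdot> u) ` mor \<C> X A = mor \<C> X B)"

definition source_morphism :: "'o \<Rightarrow> 'o \<Rightarrow> 'm \<Rightarrow> bool" where
  "source_morphism A B f \<longleftrightarrow> f \<in> mor \<C> A B \<and> \<not> is_section \<C> A B f \<and>
     (\<forall>C. \<forall>u\<in>mor \<C> A C. \<not> is_section \<C> A C u \<longrightarrow> (\<exists>v\<in>mor \<C> B C. u = v \<cdot> f)) \<and>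
     (\<forall>\<phi>\<in>mor \<C> B B. \<phi> \<cdot> f = f \<longrightarrow> is_iso \<C> B B \<phi>)"

definition sink_morphism :: "'o \<Rightarrow> 'o \<Rightarrow> 'm \<Rightarrow> bool" where
  "sink_morphism B C g \<longleftrightarrow> g \<in> mor \<C> B C \<and> \<not> is_retraction \<C> B C g \<and>
     (\<forall>A. \<forall>u\<in>mor \<C> A C. \<not> is_retraction \<C> A C u \<longrightarrow> (\<exists>v\<in>mor \<C> A B. u = g \<cdot> v)) \<and>
     (\<forall>\<phi>\<in>mor \<C> B B. g \<cdot> \<phi> = g \<longrightarrow> is_iso \<C> B B \<phi>)"

end


section \<open>Triangulated categories and Auslander-Reiten triangles\<close>

text \<open>
  \<open>Sh A\<close> is \<open>A[1]\<close>, \<open>sh f\<close> is \<open>f[1]\<close>, and \<open>(A, f, B, g, C, h) \<in> Tri\<close> means that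
  \<open>A \<rightarrow> B \<rightarrow> C \<rightarrow> A[1]\<close> with the morphisms \<open>f\<close>, \<open>g\<close>, \<open>h\<close> is a (distinguished) triangle.
\<close>

record ('k, 'o, 'm) tri_category = "('k, 'o, 'm) category" +
  Sh :: "'o \<Rightarrow> 'o"
  sh :: "'m \<Rightarrow> 'm"
  Tri :: "('o \<times> 'm \<times> 'o \<times> 'm \<times> 'o \<times> 'm) set"

text \<open>The shift functor is only required to be an additive autoequivalence.\<close>

locale triangulated_category = additive_category \<C>
  for \<C> :: "('k, 'o, 'm, 'x) tri_category_scheme" (structure) +
  assumes sh_mor: "f \<in> mor \<C> A B \<Longrightarrow> sh \<C> f \<in> mor \<C> (Sh \<C> A) (Sh \<C> B)"
    and sh_ident: "sh \<C> (ident \<C> A) = ident \<C> (Sh \<C> A)"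
    and sh_comp: "\<lbrakk>f \<in> mor \<C> A B; g \<in> mor \<C> B C\<rbrakk> \<Longrightarrow> sh \<C> (g \<cdot> f) = sh \<C> g \<cdot> sh \<C> f"
    and sh_add: "\<lbrakk>f \<in> mor \<C> A B; f' \<in> mor \<C> A B\<rbrakk>
      \<Longrightarrow> sh \<C> (f \<oplus>\<^bsub>Hom \<C> A B\<^esub> f') = sh \<C> f \<oplus>\<^bsub>Hom \<C> (Sh \<C> A) (Sh \<C> B)\<^esub> sh \<C> f'"
    and sh_fully_faithful: "bij_betw (sh \<C>) (mor \<C> A B) (mor \<C> (Sh \<C> A) (Sh \<C> B))"
    and Sh_essentially_surjective: "\<exists>A'. isomorphic \<C> (Sh \<C> A') A"
    and Tri_mor: "(A, f, B, g, C, h) \<in> Tri \<C>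
      \<Longrightarrow> f \<in> mor \<C> A B \<and> g \<in> mor \<C> B C \<and> h \<in> mor \<C> C (Sh \<C> A)"
    and TR1_iso: "\<lbrakk>(A, f, B, g, C, h) \<in> Tri \<C>;
        f' \<in> mor \<C> A' B'; g' \<in> mor \<C> B' C'; h' \<in> mor \<C> C' (Sh \<C> A');
        is_iso \<C> A A' a; is_iso \<C> B B' b; is_iso \<C> C C' c;
        b \<cdot> f = f' \<cdot> a; c \<cdot> g = g' \<cdot> b; sh \<C> a \<cdot> h = h' \<cdot> c\<rbrakk>
      \<Longrightarrow> (A', f', B', g', C', h') \<in> Tri \<C>"
    and TR1_ident: "zero_object \<C> Z
      \<Longrightarrow> (A, ident \<C> A, A, \<zero>\<^bsub>Hom \<C> A Z\<^esub>, Z, \<zero>\<^bsub>Hom \<C> Z (Sh \<C> A)\<^esub>) \<in> Tri \<C>"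
    and TR1_cone: "f \<in> mor \<C> A B \<Longrightarrow> \<exists>C g h. (A, f, B, g, C, h) \<in> Tri \<C>"
    and TR2: "\<lbrakk>f \<in> mor \<C> A B; g \<in> mor \<C> B C; h \<in> mor \<C> C (Sh \<C> A)\<rbrakk>
      \<Longrightarrow> (A, f, B, g, C, h) \<in> Tri \<C> \<longleftrightarrow>
          (B, g, C, h, Sh \<C> A, \<ominus>\<^bsub>Hom \<C> (Sh \<C> A) (Sh \<C> B)\<^esub> sh \<C> f) \<in> Tri \<C>"
    and TR3: "\<lbrakk>(A, f, B, g, C, h) \<in> Tri \<C>; (A', f', B', g', C', h') \<in> Tri \<C>;
        a \<in> mor \<C> A A'; b \<in> mor \<C> B B'; b \<cdot> f = f' \<cdot> a\<rbrakk>
      \<Longrightarrow> \<exists>c\<in>mor \<C> C C'. c \<cdot> g = g' \<cdot> b \<and> sh \<C> a \<cdot> h = h' \<cdot> c"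
    and TR4: "\<lbrakk>(A, f, B, f', D, \<delta>) \<in> Tri \<C>; (B, g, C, g', F, \<delta>') \<in> Tri \<C>;
        (A, g \<cdot> f, C, h', E, \<delta>'') \<in> Tri \<C>\<rbrakk>
      \<Longrightarrow> \<exists>d\<in>mor \<C> D E. \<exists>e\<in>mor \<C> E F.
            (D, d, E, e, F, sh \<C> f' \<cdot> \<delta>') \<in> Tri \<C> \<and>
            d \<cdot> f' = h' \<cdot> g \<and> e \<cdot> h' = g' \<and> \<delta>'' \<cdot> d = \<delta> \<and> \<delta>' \<cdot> e = sh \<C> f \<cdot> \<delta>''"

context
  fixes \<C> :: "('k, 'o, 'm, 'x) tri_category_scheme" (structure)
begin

definition AR_triangle :: "'o \<Rightarrow> 'm \<Rightarrow> 'o \<Rightarrow> 'm \<Rightarrow> 'o \<Rightarrow> 'm \<Rightarrow> bool" where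
  "AR_triangle A f B g C h \<longleftrightarrow>
     (A, f, B, g, C, h) \<in> Tri \<C> \<and> source_morphism \<C> A B f \<and> sink_morphism \<C> B C g"

definition has_AR_translation :: bool where
  "has_AR_translation \<longleftrightarrow> (\<forall>M. indecomposable \<C> M \<longrightarrow>
     (\<exists>A f B g h. AR_triangle A f B g M h) \<and> (\<exists>f B g C h. AR_triangle M f B g C h))"

text \<open>
  The translation is determined only up to isomorphism, so it is given as the relation ``\<open>N\<close> is
  (isomorphic to) \<open>\<tau> M\<close>'', and \<open>\<tau> \<X>\<close> is closed under isomorphisms.
\<close>

definition is_tau :: "'o \<Rightarrow> 'o \<Rightarrow> bool" where
  "is_tau M N \<longleftrightarrow> (\<exists>n Ms Ns. direct_sum \<C> n Ms M \<and> direct_sum \<C> n Ns N \<and>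
     (\<forall>a<n. indecomposable \<C> (Ms a) \<and> (\<exists>f B g h. AR_triangle (Ns a) f B g (Ms a) h)))"

definition tau_image :: "'o set \<Rightarrow> 'o set" where
  "tau_image \<X> = {N. \<exists>M\<in>\<X>. is_tau M N}"

end


section \<open>Extriangulated categories\<close>

text \<open>
  The groups \<open>Ext C A\<close> (contravariant in \<open>C\<close>, covariant in \<open>A\<close>) are written multiplicatively,
  so \<open>\<one>\<close> and \<open>\<otimes>\<close> are the zero and the sum of extensions; \<open>push a \<delta>\<close> and \<open>pull c \<delta>\<close> are
  \<open>a\<^sub>*\<delta>\<close> and \<open>c\<^sup>*\<delta>\<close>.
\<close>

record ('o, 'm, 'e) bifunctor =
  Ext :: "'o \<Rightarrow> 'o \<Rightarrow> 'e monoid"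
  push :: "'m \<Rightarrow> 'e \<Rightarrow> 'e"
  pull :: "'m \<Rightarrow> 'e \<Rightarrow> 'e"

locale biadditive_functor = additive_category \<C>
  for \<C> :: "('k, 'o, 'm, 'x) category_scheme" (structure) +
  fixes \<E> :: "('o, 'm, 'e, 'y) bifunctor_scheme"
  assumes Ext_group: "comm_group (Ext \<E> C A)"
    and push_hom: "a \<in> mor \<C> A A' \<Longrightarrow> push \<E> a \<in> hom (Ext \<E> C A) (Ext \<E> C A')"
    and pull_hom: "c \<in> mor \<C> C' C \<Longrightarrow> pull \<E> c \<in> hom (Ext \<E> C A) (Ext \<E> C' A)"
    and push_ident: "\<delta> \<in> carrier (Ext \<E> C A) \<Longrightarrow> push \<E> (ident \<C> A) \<delta> = \<delta>"
    and pull_ident: "\<delta> \<in> carrier (Ext \<E> C A) \<Longrightarrow> pull \<E> (ident \<C> C) \<delta> = \<delta>"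
    and push_comp: "\<lbrakk>\<delta> \<in> carrier (Ext \<E> C A); a \<in> mor \<C> A A'; a' \<in> mor \<C> A' A''\<rbrakk>
      \<Longrightarrow> push \<E> (a' \<cdot> a) \<delta> = push \<E> a' (push \<E> a \<delta>)"
    and pull_comp: "\<lbrakk>\<delta> \<in> carrier (Ext \<E> C A); c \<in> mor \<C> C' C; c' \<in> mor \<C> C'' C'\<rbrakk>
      \<Longrightarrow> pull \<E> (c \<cdot> c') \<delta> = pull \<E> c' (pull \<E> c \<delta>)"
    and push_pull: "\<lbrakk>\<delta> \<in> carrier (Ext \<E> C A); a \<in> mor \<C> A A'; c \<in> mor \<C> C' C\<rbrakk>
      \<Longrightarrow> push \<E> a (pull \<E> c \<delta>) = pull \<E> c (push \<E> a \<delta>)"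
    and push_add: "\<lbrakk>\<delta> \<in> carrier (Ext \<E> C A); a \<in> mor \<C> A A'; a' \<in> mor \<C> A A'\<rbrakk>
      \<Longrightarrow> push \<E> (a \<oplus>\<^bsub>Hom \<C> A A'\<^esub> a') \<delta> = push \<E> a \<delta> \<otimes>\<^bsub>Ext \<E> C A'\<^esub> push \<E> a' \<delta>"
    and pull_add: "\<lbrakk>\<delta> \<in> carrier (Ext \<E> C A); c \<in> mor \<C> C' C; c' \<in> mor \<C> C' C\<rbrakk>
      \<Longrightarrow> pull \<E> (c \<oplus>\<^bsub>Hom \<C> C' C\<^esub> c') \<delta> = pull \<E> c \<delta> \<otimes>\<^bsub>Ext \<E> C' A\<^esub> pull \<E> c' \<delta>"

text \<open>
  A sequence \<open>A \<rightarrow> B \<rightarrow> C\<close> with morphisms \<open>x\<close>, \<open>y\<close> is represented, for given ends \<open>A\<close> and \<open>C\<close>,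
  by \<open>(x, B, y)\<close>.
\<close>

definition seq_class ::
    "('k, 'o, 'm, 'x) category_scheme \<Rightarrow> 'o \<Rightarrow> 'o \<Rightarrow> 'm \<times> 'o \<times> 'm \<Rightarrow> ('m \<times> 'o \<times> 'm) set" where
  "seq_class \<C> A C = (\<lambda>(x, B, y). {(x', B', y').
     x' \<in> mor \<C> A B' \<and> y' \<in> mor \<C> B' C \<and>
     (\<exists>b. is_iso \<C> B B' b \<and> b \<cdot>\<^bsub>\<C>\<^esub> x = x' \<and> y' \<cdot>\<^bsub>\<C>\<^esub> b = y)})"

text \<open>A realization maps \<open>\<delta> \<in> Ext C A\<close> to \<open>\<ss> C A \<delta>\<close>, an equivalence class of sequences.\<close>

type_synonym ('o, 'm, 'e) realization = "'o \<Rightarrow> 'o \<Rightarrow> 'e \<Rightarrow> ('m \<times> 'o \<times> 'm) set"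

definition E_triangle ::
    "('o, 'm, 'e, 'y) bifunctor_scheme \<Rightarrow> ('o, 'm, 'e) realization
      \<Rightarrow> 'o \<Rightarrow> 'm \<Rightarrow> 'o \<Rightarrow> 'm \<Rightarrow> 'o \<Rightarrow> 'e \<Rightarrow> bool" where
  "E_triangle \<E> \<ss> A x B y C \<delta> \<longleftrightarrow> \<delta> \<in> carrier (Ext \<E> C A) \<and> (x, B, y) \<in> \<ss> C A \<delta>"

text \<open>
  In \<open>realize_sum\<close> the objects \<open>SA\<close>, \<open>SB\<close>, \<open>SC\<close> are \<open>A \<oplus> A'\<close>, \<open>B \<oplus> B'\<close>, \<open>C \<oplus> C'\<close>. The
  extension \<open>\<delta> \<oplus> \<delta>'\<close> corresponds to \<open>(\<delta>, 0, 0, \<delta>')\<close> under the decomposition of \<open>Ext SC SA\<close>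
  given by biadditivity, i.e. it is the sum of the extensions obtained from \<open>\<delta>\<close> and \<open>\<delta>'\<close> by
  pulling back along the projections from \<open>SC\<close> and pushing out along the injections into \<open>SA\<close>.
\<close>

locale extriangulated_category = biadditive_functor \<C> \<E>
  for \<C> :: "('k, 'o, 'm, 'x) category_scheme" (structure)
    and \<E> :: "('o, 'm, 'e, 'y) bifunctor_scheme" +
  fixes \<ss> :: "('o, 'm, 'e) realization"
  assumes realize_class: "\<delta> \<in> carrier (Ext \<E> C A)
      \<Longrightarrow> \<exists>x B y. x \<in> mor \<C> A B \<and> y \<in> mor \<C> B C \<and> \<ss> C A \<delta> = seq_class \<C> A C (x, B, y)"
    and realize_mor: "\<lbrakk>E_triangle \<E> \<ss> A x B y C \<delta>; E_triangle \<E> \<ss> A' x' B' y' C' \<delta>';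
        a \<in> mor \<C> A A'; c \<in> mor \<C> C C'; push \<E> a \<delta> = pull \<E> c \<delta>'\<rbrakk>
      \<Longrightarrow> \<exists>b\<in>mor \<C> B B'. b \<cdot> x = x' \<cdot> a \<and> y' \<cdot> b = c \<cdot> y"
    and realize_zero: "biproduct \<C> A C S i j p q
      \<Longrightarrow> \<ss> C A \<one>\<^bsub>Ext \<E> C A\<^esub> = seq_class \<C> A C (i, S, q)"
    and realize_sum: "\<lbrakk>E_triangle \<E> \<ss> A x B y C \<delta>; E_triangle \<E> \<ss> A' x' B' y' C' \<delta>';
        biproduct \<C> A A' SA iA jA pA qA; biproduct \<C> B B' SB iB jB pB qB;
        biproduct \<C> C C' SC iC jC pC qC\<rbrakk>
      \<Longrightarrow> \<ss> SC SA (push \<E> iA (pull \<E> pC \<delta>) \<otimes>\<^bsub>Ext \<E> SC SA\<^esub> push \<E> jA (pull \<E> qC \<delta>'))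
          = seq_class \<C> SA SC
              (iB \<cdot> x \<cdot> pA \<oplus>\<^bsub>Hom \<C> SA SB\<^esub> jB \<cdot> x' \<cdot> qA, SB,
               iC \<cdot> y \<cdot> pB \<oplus>\<^bsub>Hom \<C> SB SC\<^esub> jC \<cdot> y' \<cdot> qB)"
    and ET3: "\<lbrakk>E_triangle \<E> \<ss> A x B y C \<delta>; E_triangle \<E> \<ss> A' x' B' y' C' \<delta>';
        a \<in> mor \<C> A A'; b \<in> mor \<C> B B'; b \<cdot> x = x' \<cdot> a\<rbrakk>
      \<Longrightarrow> \<exists>c\<in>mor \<C> C C'. push \<E> a \<delta> = pull \<E> c \<delta>' \<and> c \<cdot> y = y' \<cdot> b"
    and ET3_op: "\<lbrakk>E_triangle \<E> \<ss> A x B y C \<delta>; E_triangle \<E> \<ss> A' x' B' y' C' \<delta>';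
        b \<in> mor \<C> B B'; c \<in> mor \<C> C C'; c \<cdot> y = y' \<cdot> b\<rbrakk>
      \<Longrightarrow> \<exists>a\<in>mor \<C> A A'. push \<E> a \<delta> = pull \<E> c \<delta>' \<and> b \<cdot> x = x' \<cdot> a"
    and ET4: "\<lbrakk>E_triangle \<E> \<ss> A f B f' D \<delta>; E_triangle \<E> \<ss> B g C g' F \<delta>'\<rbrakk>
      \<Longrightarrow> \<exists>E. \<exists>h'\<in>mor \<C> C E. \<exists>d\<in>mor \<C> D E. \<exists>e\<in>mor \<C> E F. \<exists>\<delta>''.
            h' \<cdot> g = d \<cdot> f' \<and> e \<cdot> h' = g' \<and>
            E_triangle \<E> \<ss> A (g \<cdot> f) C h' E \<delta>'' \<and>
            E_triangle \<E> \<ss> D d E e F (push \<E> f' \<delta>') \<and>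
            pull \<E> d \<delta>'' = \<delta> \<and> push \<E> f \<delta>'' = pull \<E> e \<delta>'"
    and ET4_op: "\<lbrakk>E_triangle \<E> \<ss> D f' A f B \<delta>; E_triangle \<E> \<ss> F g' B g C \<delta>'\<rbrakk>
      \<Longrightarrow> \<exists>E. \<exists>d\<in>mor \<C> D E. \<exists>e\<in>mor \<C> E F. \<exists>h'\<in>mor \<C> E A. \<exists>\<delta>''.
            h' \<cdot> d = f' \<and> f \<cdot> h' = g' \<cdot> e \<and>
            E_triangle \<E> \<ss> E h' A (g \<cdot> f) C \<delta>'' \<and>
            E_triangle \<E> \<ss> D d E e F (pull \<E> g' \<delta>) \<and>
            push \<E> e \<delta>'' = \<delta>' \<and> push \<E> d \<delta> = pull \<E> g \<delta>''"

context
  fixes \<C> :: "('k, 'o, 'm, 'x) category_scheme" (structure)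
    and \<E> :: "('o, 'm, 'e, 'y) bifunctor_scheme"
    and \<ss> :: "('o, 'm, 'e) realization"
begin

definition projective :: "'o \<Rightarrow> bool" where
  "projective P \<longleftrightarrow> (\<forall>A x B y C \<delta>. E_triangle \<E> \<ss> A x B y C \<delta> \<longrightarrow>
     (\<forall>u\<in>mor \<C> P C. \<exists>v\<in>mor \<C> P B. u = y \<cdot> v))"

definition injective :: "'o \<Rightarrow> bool" where
  "injective I \<longleftrightarrow> (\<forall>A x B y C \<delta>. E_triangle \<E> \<ss> A x B y C \<delta> \<longrightarrow>
     (\<forall>u\<in>mor \<C> A I. \<exists>v\<in>mor \<C> B I. u = v \<cdot> x))"

definition enough_projectives :: bool where
  "enough_projectives \<longleftrightarrow> (\<forall>C. \<exists>A x P y \<delta>. E_triangle \<E> \<ss> A x P y C \<delta> \<and> projective P)"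

definition enough_injectives :: bool where
  "enough_injectives \<longleftrightarrow> (\<forall>A. \<exists>x I y C \<delta>. E_triangle \<E> \<ss> A x I y C \<delta> \<and> injective I)"

definition frobenius_extriangulated_category :: bool where
  "frobenius_extriangulated_category \<longleftrightarrow> extriangulated_category \<C> \<E> \<ss> \<and>
     enough_projectives \<and> enough_injectives \<and> (\<forall>P. projective P \<longleftrightarrow> injective P)"

end


section \<open>The relative structure on a triangulated category\<close>

definition rel_Ext ::
    "('k, 'o, 'm, 'x) tri_category_scheme \<Rightarrow> 'o set \<Rightarrow> ('o, 'm, 'm) bifunctor" where
  "rel_Ext \<C> \<X> =
     \<lparr>Ext = (\<lambda>C A.
        \<lparr>carrier = {\<delta> \<in> mor \<C> C (Sh \<C> A).
           \<exists>f B g. (A, f, B, g, C, \<delta>) \<in> Tri \<C> \<and> monic_wrt \<C> \<X> A B f},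
         mult = add (Hom \<C> C (Sh \<C> A)), one = \<zero>\<^bsub>Hom \<C> C (Sh \<C> A)\<^esub>\<rparr>),
      push = (\<lambda>a \<delta>. sh \<C> a \<cdot>\<^bsub>\<C>\<^esub> \<delta>),
      pull = (\<lambda>c \<delta>. \<delta> \<cdot>\<^bsub>\<C>\<^esub> c)\<rparr>"

text \<open>
  The middle term of a triangle on \<open>\<delta>\<close> is not unique. Taking the union over all choices avoids an
  arbitrary selection; that the union is a single class is part of \<open>realize_class\<close>.
\<close>

definition rel_real ::
    "('k, 'o, 'm, 'x) tri_category_scheme \<Rightarrow> ('o, 'm, 'm) realization" where
  "rel_real \<C> C A \<delta> =
     (\<Union>(f, B, g)\<in>{(f, B, g). (A, f, B, g, C, \<delta>) \<in> Tri \<C>}. seq_class \<C> A C (f, B, g))"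

end

(*
  Both directions of part (1) rest on the Auslander-Reiten triangles. For a triangle with third
  morphism h : C -> A[1], the map f is X-monic iff u[1] h = 0 for all u : A -> X, and g is X-epic iff
  h v = 0 for all v : X -> C. If h v is nonzero for an indecomposable X, then some a : A -> tau X makes
  a[1] h v the (nonzero) third morphism of the Auslander-Reiten triangle ending in X, so a[1] h is
  nonzero; the converse is dual. Hence E'(C, A) consists of the morphisms C -> A[1] killed by all
  X -> C, equivalently by all A -> X: it is closed under pushing out and pulling back, and E'-triangles
  are closed under composition on both sides, so the axioms are inherited from the triangulated
  structure. Approximations complete to E'-triangles, which provides enough projectives and
  injectives; a projective or injective object splits off its approximation and thus lies in X.
*)

theory Submission
  imports Defs
begin

section \<open>Additive categories\<close>

text \<open>The shift is only an autoequivalence, so there is no inverse shift to rotate backwards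
  with: an object needed as a first or middle term is found by replacing a cone by an isomorphic
  shifted object, and morphisms between shifted objects are unshifted by full faithfulness, the
  signs of TR2 being tracked throughout. Middle terms of triangles are not functorial, so uniqueness
  of realizations, split triangles and sums of triangles have to be derived. In place of the five
  lemma stands a nilpotency argument: an endomorphism of the middle term compatible with the
  identities of both ends differs from the identity by a morphism of square zero.

  Part (1) also opens both octahedral axioms: E'-triangles composed along first morphisms are
  controlled by composing X-monic morphisms, those composed along second morphisms by composing
  X-epic ones, and the two descriptions agree. The two inclusions in tau X = X serve the two
  directions of part (1): tau X inside X for monic implies epic, X inside tau X for the
  converse.\<close>

sublocale additive_category \<subseteq> Hom: abelian_group "Hom \<C> A B" for A B
  by (rule Hom_group)

context additive_category
begin

section \<open>Zero morphisms, signs and finite sums\<close>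

lemma zero_mor [simp, intro]: "\<zero>\<^bsub>Hom \<C> A B\<^esub> \<in> mor \<C> A B"
  by (rule Hom.zero_closed)

lemma comp_zero [simp]:
  assumes "g \<in> mor \<C> B C"
  shows "g \<cdot> \<zero>\<^bsub>Hom \<C> A B\<^esub> = \<zero>\<^bsub>Hom \<C> A C\<^esub>"
proof -
  let ?z = "\<zero>\<^bsub>Hom \<C> A B\<^esub>"
  have m: "g \<cdot> ?z \<in> mor \<C> A C"
    using assms by (blast intro: comp_mor)
  have "g \<cdot> ?z \<oplus>\<^bsub>Hom \<C> A C\<^esub> g \<cdot> ?z = g \<cdot> ?z"
    using comp_add[of ?z A B ?z g C] assms by simp
  then show ?thesis
    using m Hom.add.l_cancel_one by blast
qed

lemma zero_comp [simp]:
  assumes "f \<in> mor \<C> A B"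
  shows "\<zero>\<^bsub>Hom \<C> B C\<^esub> \<cdot> f = \<zero>\<^bsub>Hom \<C> A C\<^esub>"
proof -
  let ?z = "\<zero>\<^bsub>Hom \<C> B C\<^esub>"
  have m: "?z \<cdot> f \<in> mor \<C> A C"
    using assms by (blast intro: comp_mor)
  have "?z \<cdot> f \<oplus>\<^bsub>Hom \<C> A C\<^esub> ?z \<cdot> f = ?z \<cdot> f"
    using add_comp[of f A B ?z C ?z] assms by simp
  then show ?thesis
    using m Hom.add.l_cancel_one by blast
qed

lemma zero_comp_zero [simp]:
  "\<zero>\<^bsub>Hom \<C> B C\<^esub> \<cdot> \<zero>\<^bsub>Hom \<C> A B\<^esub> = \<zero>\<^bsub>Hom \<C> A C\<^esub>"
  by (rule comp_zero[OF zero_mor])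

lemma uminus_zero [simp]: "\<ominus>\<^bsub>Hom \<C> A B\<^esub> \<zero>\<^bsub>Hom \<C> A B\<^esub> = \<zero>\<^bsub>Hom \<C> A B\<^esub>"
  by (simp add: Hom.minus_equality)

lemma comp_uminus:
  assumes "f \<in> mor \<C> A B" "g \<in> mor \<C> B C"
  shows "g \<cdot> (\<ominus>\<^bsub>Hom \<C> A B\<^esub> f) = \<ominus>\<^bsub>Hom \<C> A C\<^esub> (g \<cdot> f)"
proof -
  have m: "\<ominus>\<^bsub>Hom \<C> A B\<^esub> f \<in> mor \<C> A B"
    using assms by simp
  have "g \<cdot> (\<ominus>\<^bsub>Hom \<C> A B\<^esub> f) \<oplus>\<^bsub>Hom \<C> A C\<^esub> g \<cdot> f = \<zero>\<^bsub>Hom \<C> A C\<^esub>"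
    using comp_add[OF m assms] assms Hom.l_neg[OF assms(1)] by simp
  then show ?thesis
    using Hom.minus_equality comp_mor[OF m assms(2)] comp_mor[OF assms] by metis
qed

lemma uminus_comp:
  assumes "f \<in> mor \<C> A B" "g \<in> mor \<C> B C"
  shows "(\<ominus>\<^bsub>Hom \<C> B C\<^esub> g) \<cdot> f = \<ominus>\<^bsub>Hom \<C> A C\<^esub> (g \<cdot> f)"
proof -
  have m: "\<ominus>\<^bsub>Hom \<C> B C\<^esub> g \<in> mor \<C> B C"
    using assms by simp
  have "(\<ominus>\<^bsub>Hom \<C> B C\<^esub> g) \<cdot> f \<oplus>\<^bsub>Hom \<C> A C\<^esub> g \<cdot> f = \<zero>\<^bsub>Hom \<C> A C\<^esub>"
    using add_comp[OF assms(1) m assms(2)] assms Hom.l_neg[OF assms(2)] by simp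
  then show ?thesis
    using Hom.minus_equality comp_mor[OF assms(1) m] comp_mor[OF assms] by metis
qed

lemma comp_finsum:
  fixes n :: nat
  assumes "\<And>a. a < n \<Longrightarrow> f a \<in> mor \<C> A B" "g \<in> mor \<C> B C"
  shows "g \<cdot> (\<Oplus>\<^bsub>Hom \<C> A B\<^esub>a\<in>{..<n}. f a) = (\<Oplus>\<^bsub>Hom \<C> A C\<^esub>a\<in>{..<n}. g \<cdot> f a)"
  using assms(1)
proof (induction n)
  case 0
  then show ?case
    using assms(2) by simp
next
  case (Suc n)
  have f: "f \<in> {..<n} \<rightarrow> mor \<C> A B" "f n \<in> mor \<C> A B"
    using Suc.prems by auto
  moreover have "(\<lambda>a. g \<cdot> f a) \<in> {..<n} \<rightarrow> mor \<C> A C" "g \<cdot> f n \<in> mor \<C> A C"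
    using f assms(2) comp_mor by blast+
  ultimately show ?case
    using Suc.IH Suc.prems comp_add[OF f(2) Hom.finsum_closed[OF f(1)] assms(2)]
    by (simp add: lessThan_Suc)
qed

lemma finsum_comp:
  fixes n :: nat
  assumes "\<And>a. a < n \<Longrightarrow> g a \<in> mor \<C> B C" "f \<in> mor \<C> A B"
  shows "(\<Oplus>\<^bsub>Hom \<C> B C\<^esub>a\<in>{..<n}. g a) \<cdot> f = (\<Oplus>\<^bsub>Hom \<C> A C\<^esub>a\<in>{..<n}. g a \<cdot> f)"
  using assms(1)
proof (induction n)
  case 0
  then show ?case
    using assms(2) by simp
next
  case (Suc n)
  have g: "g \<in> {..<n} \<rightarrow> mor \<C> B C" "g n \<in> mor \<C> B C"
    using Suc.prems by auto
  moreover have "(\<lambda>a. g a \<cdot> f) \<in> {..<n} \<rightarrow> mor \<C> A C" "g n \<cdot> f \<in> mor \<C> A C"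
    using g assms(2) comp_mor by blast+
  ultimately show ?case
    using Suc.IH Suc.prems add_comp[OF assms(2) g(2) Hom.finsum_closed[OF g(1)]]
    by (simp add: lessThan_Suc)
qed

section \<open>Direct sums, idempotents and indecomposability\<close>

text \<open>Writing the identity of \<open>S\<close> as the sum of the
  \<open>i a \<cdot> p a\<close> and composing with \<open>v\<close> or \<open>u\<close> reduces
  everything to the summands. In this form a morphism out of or into a member of \<open>\<X>\<close>
  is reduced to the terms of Auslander-Reiten triangles.\<close>

lemma direct_sum_separated:
  assumes "direct_sum \<C> n X S"
  shows "\<exists>i p. (\<forall>a<n. i a \<in> mor \<C> (X a) S \<and> p a \<in> mor \<C> S (X a)) \<and>
    (\<forall>T. \<forall>v\<in>mor \<C> S T. (\<forall>a<n. v \<cdot> i a = \<zero>\<^bsub>Hom \<C> (X a) T\<^esub>) \<longrightarrow> v = \<zero>\<^bsub>Hom \<C> S T\<^esub>) \<and>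
    (\<forall>T. \<forall>u\<in>mor \<C> T S. (\<forall>a<n. p a \<cdot> u = \<zero>\<^bsub>Hom \<C> T (X a)\<^esub>) \<longrightarrow> u = \<zero>\<^bsub>Hom \<C> T S\<^esub>)"
proof -
  obtain i p where i: "\<And>a. a < n \<Longrightarrow> i a \<in> mor \<C> (X a) S"
    and p: "\<And>a. a < n \<Longrightarrow> p a \<in> mor \<C> S (X a)"
    and sum: "(\<Oplus>\<^bsub>Hom \<C> S S\<^esub>a\<in>{..<n}. i a \<cdot> p a) = ident \<C> S"
    using assms unfolding direct_sum_def by blast
  have ip: "\<And>a. a < n \<Longrightarrow> i a \<cdot> p a \<in> mor \<C> S S"
    using i p comp_mor by blast
  have zi: "v = \<zero>\<^bsub>Hom \<C> S T\<^esub>"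
    if v: "v \<in> mor \<C> S T" and 0: "\<And>a. a < n \<Longrightarrow> v \<cdot> i a = \<zero>\<^bsub>Hom \<C> (X a) T\<^esub>" for T v
  proof -
    have "v = v \<cdot> (\<Oplus>\<^bsub>Hom \<C> S S\<^esub>a\<in>{..<n}. i a \<cdot> p a)"
      using v sum by (simp add: comp_ident)
    also have "\<dots> = (\<Oplus>\<^bsub>Hom \<C> S T\<^esub>a\<in>{..<n}. v \<cdot> (i a \<cdot> p a))"
      using ip v by (rule comp_finsum)
    also have "\<dots> = (\<Oplus>\<^bsub>Hom \<C> S T\<^esub>a\<in>{..<n}. \<zero>\<^bsub>Hom \<C> S T\<^esub>)"
      using 0 p by (intro Hom.finsum_cong') (auto simp: comp_assoc[OF p i v, symmetric])
    finally show ?thesis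
      by (simp add: Hom.finsum_zero)
  qed
  have zp: "u = \<zero>\<^bsub>Hom \<C> T S\<^esub>"
    if u: "u \<in> mor \<C> T S" and 0: "\<And>a. a < n \<Longrightarrow> p a \<cdot> u = \<zero>\<^bsub>Hom \<C> T (X a)\<^esub>" for T u
  proof -
    have "u = (\<Oplus>\<^bsub>Hom \<C> S S\<^esub>a\<in>{..<n}. i a \<cdot> p a) \<cdot> u"
      using u sum by (simp add: ident_comp)
    also have "\<dots> = (\<Oplus>\<^bsub>Hom \<C> T S\<^esub>a\<in>{..<n}. (i a \<cdot> p a) \<cdot> u)"
      using ip u by (rule finsum_comp)
    also have "\<dots> = (\<Oplus>\<^bsub>Hom \<C> T S\<^esub>a\<in>{..<n}. \<zero>\<^bsub>Hom \<C> T S\<^esub>)"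
      using 0 i by (intro Hom.finsum_cong') (auto simp: comp_assoc[OF u p i])
    finally show ?thesis
      by (simp add: Hom.finsum_zero)
  qed
  show ?thesis
    using i p zi zp by (intro exI[of _ i] exI[of _ p]) simp
qed

lemma direct_sum_single: "direct_sum \<C> 1 (\<lambda>_. A) A"
  unfolding direct_sum_def
  by (intro exI[of _ "\<lambda>_. ident \<C> A"])
    (simp add: ident_mor ident_comp[OF ident_mor] lessThan_Suc Hom.finsum_insert)

text \<open>Closure under summands is phrased with indexed families, while split triangles produce a
  \<open>biproduct\<close>; this is the bridge, with \<open>A\<close> at index 0 and
  \<open>B\<close> at index 1.\<close>

lemma biproduct_imp_direct_sum:
  assumes "biproduct \<C> A B S i j p q"
  shows "direct_sum \<C> 2 (\<lambda>a. if a = 0 then A else B) S"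
proof -
  have m: "i \<cdot> p \<in> mor \<C> S S" "j \<cdot> q \<in> mor \<C> S S"
    using assms comp_mor unfolding biproduct_def by blast+
  \<comment> \<open>\<open>lessThan_Suc\<close> splits off the largest index first, hence the
    reversed order of the two terms and the later use of \<open>Hom.a_comm\<close>.\<close>
  have "(\<Oplus>\<^bsub>Hom \<C> S S\<^esub>a\<in>{..<2}. (if a = (0::nat) then i else j) \<cdot> (if a = 0 then p else q)) =
        j \<cdot> q \<oplus>\<^bsub>Hom \<C> S S\<^esub> i \<cdot> p"
    using m by (simp add: numeral_2_eq_2 lessThan_Suc Hom.finsum_insert)
  with assms m show ?thesis
    unfolding direct_sum_def biproduct_def
    by (intro exI[of _ "\<lambda>a. if a = 0 then i else j"] exI[of _ "\<lambda>a. if a = 0 then p else q"])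
      (auto simp: less_2_cases_iff Hom.a_comm)
qed

lemma zero_objectI:
  assumes "ident \<C> A = \<zero>\<^bsub>Hom \<C> A A\<^esub>"
  shows "zero_object \<C> A"
proof -
  have "f = \<zero>\<^bsub>Hom \<C> B A\<^esub>" if "f \<in> mor \<C> B A" for f B
    using ident_comp[OF that] that by (simp add: assms)
  moreover have "f = \<zero>\<^bsub>Hom \<C> A B\<^esub>" if "f \<in> mor \<C> A B" for f B
    using comp_ident[OF that] that by (simp add: assms)
  ultimately show ?thesis
    unfolding zero_object_def by blast
qed

lemma Units_idempotent:
  assumes "ring R" "e \<in> Units R" "e \<otimes>\<^bsub>R\<^esub> e = e"
  shows "e = \<one>\<^bsub>R\<^esub>"
proof -
  interpret ring R by fact
  show ?thesis
    using assms Units_closed Units_l_cancel r_one one_closed by metis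
qed

lemma biproduct_fst_invertible:
  assumes b: "biproduct \<C> A B M i j p q" and ip: "i \<cdot> p = ident \<C> M"
  shows "zero_object \<C> B"
proof (rule zero_objectI)
  have m: "i \<in> mor \<C> A M" "j \<in> mor \<C> B M" "p \<in> mor \<C> M A" "q \<in> mor \<C> M B"
    using b unfolding biproduct_def by auto
  have "ident \<C> B = q \<cdot> ((i \<cdot> p) \<cdot> j)"
    using b m unfolding biproduct_def ip by (simp add: ident_comp)
  also have "\<dots> = q \<cdot> (i \<cdot> (p \<cdot> j))"
    using m by (simp add: comp_assoc)
  also have "\<dots> = \<zero>\<^bsub>Hom \<C> B B\<^esub>"
    using b m unfolding biproduct_def by simp
  finally show "ident \<C> B = \<zero>\<^bsub>Hom \<C> B B\<^esub>" .
qed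

lemma biproduct_swap:
  assumes "biproduct \<C> A B M i j p q"
  shows "biproduct \<C> B A M j i q p"
proof -
  have "i \<cdot> p \<in> mor \<C> M M" "j \<cdot> q \<in> mor \<C> M M"
    using assms comp_mor unfolding biproduct_def by blast+
  then show ?thesis
    using assms unfolding biproduct_def by (auto simp: Hom.a_comm)
qed

lemma biproduct_idempotent:
  assumes "biproduct \<C> A B M i j p q"
  shows "(i \<cdot> p) \<cdot> (i \<cdot> p) = i \<cdot> p"
proof -
  have m: "i \<in> mor \<C> A M" "p \<in> mor \<C> M A" "p \<cdot> i = ident \<C> A"
    using assms unfolding biproduct_def by auto
  have "(i \<cdot> p) \<cdot> (i \<cdot> p) = i \<cdot> ((p \<cdot> i) \<cdot> p)"
    using comp_assoc[OF comp_mor[OF m(2,1)] m(2,1)] comp_assoc[OF m(2,1,2)] by metis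
  then show ?thesis
    using m by (simp add: ident_comp)
qed

text \<open>A decomposition of \<open>M\<close> writes the identity as a sum of the idempotents
  \<open>i \<cdot> p\<close> and \<open>j \<cdot> q\<close>. In a local ring one of them is a unit,
  an idempotent unit is the identity, and then the other summand vanishes. Needed because
  \<open>krull_schmidt\<close> supplies local endomorphism rings, whereas the existence of
  Auslander-Reiten triangles is stated for indecomposable objects.\<close>

lemma local_End_indecomposable:
  assumes "local_ring (End_ring \<C> M)"
  shows "indecomposable \<C> M"
proof -
  let ?R = "End_ring \<C> M"
  have R: "ring ?R" and ne: "ident \<C> M \<noteq> \<zero>\<^bsub>Hom \<C> M M\<^esub>"
    and loc: "\<And>a b. a \<in> carrier ?R - Units ?R \<Longrightarrow> b \<in> carrier ?R - Units ?R \<Longrightarrow> a \<oplus>\<^bsub>?R\<^esub> b \<notin> Units ?R"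
    using assms unfolding local_ring_def by (auto simp: End_ring_def)
  interpret R: ring ?R by fact
  have "zero_object \<C> A \<or> zero_object \<C> B" if b: "biproduct \<C> A B M i j p q" for A B i j p q
  proof -
    have m: "i \<cdot> p \<in> carrier ?R" "j \<cdot> q \<in> carrier ?R"
      using b comp_mor unfolding biproduct_def End_ring_def by (auto 0 3)
    have "i \<cdot> p \<oplus>\<^bsub>?R\<^esub> j \<cdot> q = \<one>\<^bsub>?R\<^esub>"
      using b unfolding biproduct_def End_ring_def by simp
    then have "i \<cdot> p \<in> Units ?R \<or> j \<cdot> q \<in> Units ?R"
      using loc[of "i \<cdot> p" "j \<cdot> q"] m R.Units_one_closed by auto
    moreover have "i \<cdot> p = ident \<C> M" if "i \<cdot> p \<in> Units ?R"
      using Units_idempotent[OF R that] biproduct_idempotent[OF b] by (simp add: End_ring_def)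
    moreover have "j \<cdot> q = ident \<C> M" if "j \<cdot> q \<in> Units ?R"
      using Units_idempotent[OF R that] biproduct_idempotent[OF biproduct_swap[OF b]]
      by (simp add: End_ring_def)
    ultimately show ?thesis
      using biproduct_fst_invertible[OF b] biproduct_fst_invertible[OF biproduct_swap[OF b]] by blast
  qed
  moreover have "\<not> zero_object \<C> M"
    using ne ident_mor unfolding zero_object_def by blast
  ultimately show ?thesis
    unfolding indecomposable_def by blast
qed

section \<open>Recognising isomorphisms without a five lemma\<close>

lemma is_iso_ident: "is_iso \<C> A A (ident \<C> A)"
  unfolding is_iso_def using ident_mor ident_comp by blast

text \<open>The inverse of \<open>1 + n\<close> is \<open>1 - n\<close>, because \<open>n\<close>
  has square zero.\<close>

lemma is_iso_unipotent:
  assumes n: "n \<in> mor \<C> M M" "n \<cdot> n = \<zero>\<^bsub>Hom \<C> M M\<^esub>"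
  shows "is_iso \<C> M M (ident \<C> M \<oplus>\<^bsub>Hom \<C> M M\<^esub> n)"
proof -
  let ?H = "Hom \<C> M M" and ?id = "ident \<C> M"
  have i: "?id \<in> mor \<C> M M"
    by (rule ident_mor)
  have m: "\<ominus>\<^bsub>?H\<^esub> n \<in> mor \<C> M M" "?id \<oplus>\<^bsub>?H\<^esub> n \<in> mor \<C> M M" "?id \<oplus>\<^bsub>?H\<^esub> \<ominus>\<^bsub>?H\<^esub> n \<in> mor \<C> M M"
    using n i by auto
  have nn: "(\<ominus>\<^bsub>?H\<^esub> n) \<cdot> n = \<zero>\<^bsub>?H\<^esub>" "n \<cdot> (\<ominus>\<^bsub>?H\<^esub> n) = \<zero>\<^bsub>?H\<^esub>"
    using n by (simp_all add: uminus_comp[of _ M M] comp_uminus[of _ M M])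
  have "(?id \<oplus>\<^bsub>?H\<^esub> \<ominus>\<^bsub>?H\<^esub> n) \<cdot> (?id \<oplus>\<^bsub>?H\<^esub> n) = ?id"
    using n m i nn
    by (simp add: comp_add[of _ M M _ _ M] add_comp[of _ M M _ M] ident_comp[of _ M M] comp_ident[of _ M M]
        Hom.a_assoc Hom.l_neg)
  moreover have "(?id \<oplus>\<^bsub>?H\<^esub> n) \<cdot> (?id \<oplus>\<^bsub>?H\<^esub> \<ominus>\<^bsub>?H\<^esub> n) = ?id"
    using n m i nn
    by (simp add: comp_add[of _ M M _ _ M] add_comp[of _ M M _ M] ident_comp[of _ M M] comp_ident[of _ M M]
        Hom.a_assoc Hom.r_neg)
  ultimately show ?thesis
    using m unfolding is_iso_def by blast
qed

text \<open>The morphism \<open>c\<close> need not be the inverse of \<open>b\<close>: comparison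
  morphisms found in both directions are not chosen compatibly. Correcting \<open>c\<close> on
  either side gives a left inverse \<open>l \<cdot> c\<close> and a right inverse
  \<open>c \<cdot> r\<close> of \<open>b\<close>, and these coincide.\<close>

lemma is_iso_if_compositions:
  assumes b: "b \<in> mor \<C> M N" and c: "c \<in> mor \<C> N M"
    and "is_iso \<C> M M (c \<cdot> b)" "is_iso \<C> N N (b \<cdot> c)"
  shows "is_iso \<C> M N b"
proof -
  obtain l where l: "l \<in> mor \<C> M M" "l \<cdot> (c \<cdot> b) = ident \<C> M"
    using assms(3) unfolding is_iso_def by blast
  obtain r where r: "r \<in> mor \<C> N N" "(b \<cdot> c) \<cdot> r = ident \<C> N"
    using assms(4) unfolding is_iso_def by blast
  have lc: "l \<cdot> c \<in> mor \<C> N M" "(l \<cdot> c) \<cdot> b = ident \<C> M"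
    using l b c by (auto simp: comp_assoc intro: comp_mor)
  have cr: "c \<cdot> r \<in> mor \<C> N M" "b \<cdot> (c \<cdot> r) = ident \<C> N"
    using r b c by (auto simp: comp_assoc intro: comp_mor)
  have "l \<cdot> c = (l \<cdot> c) \<cdot> (b \<cdot> (c \<cdot> r))"
    using lc cr by (simp add: comp_ident)
  also have "\<dots> = ((l \<cdot> c) \<cdot> b) \<cdot> (c \<cdot> r)"
    using comp_assoc[OF cr(1) b lc(1)] by simp
  also have "\<dots> = c \<cdot> r"
    using lc cr by (simp add: ident_comp)
  finally show ?thesis
    using b lc cr unfolding is_iso_def by metis
qed

text \<open>The defect \<open>n\<close> of \<open>\<phi>\<close> from the identity factors through \<open>x\<close> and kills \<open>x\<close>, so \<open>n\<^sup>2 = 0\<close>.\<close>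

lemma is_iso_endo:
  assumes x: "x \<in> mor \<C> A M" and y: "y \<in> mor \<C> M C" and \<phi>: "\<phi> \<in> mor \<C> M M" "\<phi> \<cdot> x = x" "y \<cdot> \<phi> = y"
    and ker: "\<And>n. n \<in> mor \<C> M M \<Longrightarrow> y \<cdot> n = \<zero>\<^bsub>Hom \<C> M C\<^esub> \<Longrightarrow> \<exists>w\<in>mor \<C> M A. n = x \<cdot> w"
  shows "is_iso \<C> M M \<phi>"
proof -
  let ?H = "Hom \<C> M M"
  let ?n = "\<phi> \<oplus>\<^bsub>?H\<^esub> \<ominus>\<^bsub>?H\<^esub> (ident \<C> M)"
  have i: "ident \<C> M \<in> mor \<C> M M" "\<ominus>\<^bsub>?H\<^esub> (ident \<C> M) \<in> mor \<C> M M"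
    by (simp_all add: ident_mor)
  then have n: "?n \<in> mor \<C> M M"
    using \<phi> by simp
  have "?n \<cdot> x = \<zero>\<^bsub>Hom \<C> A M\<^esub>"
    using add_comp[OF x \<phi>(1) i(2)] x \<phi> i by (simp add: uminus_comp[OF x] ident_comp Hom.r_neg)
  moreover have "y \<cdot> ?n = \<zero>\<^bsub>Hom \<C> M C\<^esub>"
    using comp_add[OF \<phi>(1) i(2) y] y \<phi> i by (simp add: comp_uminus[OF _ y] comp_ident Hom.r_neg)
  then obtain w where w: "w \<in> mor \<C> M A" "?n = x \<cdot> w"
    using ker n by blast
  ultimately have "?n \<cdot> ?n = \<zero>\<^bsub>?H\<^esub>"
    using comp_assoc[OF w(1) x n] by simp
  moreover have "ident \<C> M \<oplus>\<^bsub>?H\<^esub> ?n = \<phi>"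
    using \<phi> i by (simp add: Hom.a_lcomm[of "ident \<C> M"] Hom.r_neg)
  ultimately show ?thesis
    using is_iso_unipotent[OF n] by metis
qed

section \<open>Calculus of biproducts; composites of relative monics and epics\<close>

lemma biproductD:
  assumes "biproduct \<C> A B S i j p q"
  shows "i \<in> mor \<C> A S" "j \<in> mor \<C> B S" "p \<in> mor \<C> S A" "q \<in> mor \<C> S B"
    "p \<cdot> i = ident \<C> A" "q \<cdot> j = ident \<C> B"
    "p \<cdot> j = \<zero>\<^bsub>Hom \<C> B A\<^esub>" "q \<cdot> i = \<zero>\<^bsub>Hom \<C> A B\<^esub>"
    "i \<cdot> p \<oplus>\<^bsub>Hom \<C> S S\<^esub> j \<cdot> q = ident \<C> S"
  using assms unfolding biproduct_def by auto

text \<open>The morphism out of \<open>S\<close> is kept as an explicit sum, since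
  \<open>realize_sum\<close> prescribes the morphisms between direct sums in exactly this
  shape.\<close>

lemma biproduct_sum_comp:
  assumes b: "biproduct \<C> A B S i j p q" and u: "u \<in> mor \<C> A T" and v: "v \<in> mor \<C> B T"
  shows "u \<cdot> p \<oplus>\<^bsub>Hom \<C> S T\<^esub> v \<cdot> q \<in> mor \<C> S T"
    "(u \<cdot> p \<oplus>\<^bsub>Hom \<C> S T\<^esub> v \<cdot> q) \<cdot> i = u" "(u \<cdot> p \<oplus>\<^bsub>Hom \<C> S T\<^esub> v \<cdot> q) \<cdot> j = v"
proof -
  note B = biproductD[OF b]
  have m: "u \<cdot> p \<in> mor \<C> S T" "v \<cdot> q \<in> mor \<C> S T"
    using B u v comp_mor by blast+
  then show "u \<cdot> p \<oplus>\<^bsub>Hom \<C> S T\<^esub> v \<cdot> q \<in> mor \<C> S T"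
    by simp
  show "(u \<cdot> p \<oplus>\<^bsub>Hom \<C> S T\<^esub> v \<cdot> q) \<cdot> i = u"
    using add_comp[OF B(1) m] comp_assoc[OF B(1,3) u] comp_assoc[OF B(1,4) v] B u v
    by (simp add: comp_ident)
  show "(u \<cdot> p \<oplus>\<^bsub>Hom \<C> S T\<^esub> v \<cdot> q) \<cdot> j = v"
    using add_comp[OF B(2) m] comp_assoc[OF B(2,3) u] comp_assoc[OF B(2,4) v] B u v
    by (simp add: comp_ident)
qed

lemma biproduct_pair:
  assumes b: "biproduct \<C> A B S i j p q" and u: "u \<in> mor \<C> T A" and v: "v \<in> mor \<C> T B"
  obtains c where "c \<in> mor \<C> T S" "p \<cdot> c = u" "q \<cdot> c = v"
proof
  note B = biproductD[OF b]
  have m: "i \<cdot> u \<in> mor \<C> T S" "j \<cdot> v \<in> mor \<C> T S"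
    using B u v comp_mor by blast+
  then show "i \<cdot> u \<oplus>\<^bsub>Hom \<C> T S\<^esub> j \<cdot> v \<in> mor \<C> T S"
    by simp
  show "p \<cdot> (i \<cdot> u \<oplus>\<^bsub>Hom \<C> T S\<^esub> j \<cdot> v) = u"
    using comp_add[OF m B(3)] comp_assoc[OF u B(1,3), symmetric] comp_assoc[OF v B(2,3), symmetric] B u v
    by (simp add: ident_comp)
  show "q \<cdot> (i \<cdot> u \<oplus>\<^bsub>Hom \<C> T S\<^esub> j \<cdot> v) = v"
    using comp_add[OF m B(4)] comp_assoc[OF u B(1,4), symmetric] comp_assoc[OF v B(2,4), symmetric] B u v
    by (simp add: ident_comp)
qed

lemma biproduct_copair:
  assumes "biproduct \<C> A B S i j p q" "u \<in> mor \<C> A T" "v \<in> mor \<C> B T"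
  obtains c where "c \<in> mor \<C> S T" "c \<cdot> i = u" "c \<cdot> j = v"
  using biproduct_sum_comp[OF assms] by blast

text \<open>Composing \<open>c\<close> with \<open>i \<cdot> p + j \<cdot> q = 1\<close> recovers
  \<open>c\<close> from its two components, so the injections are jointly epic; the projections are
  jointly monic for the same reason.\<close>

lemma biproduct_eqI_copair:
  assumes b: "biproduct \<C> A B S i j p q" and c: "c \<in> mor \<C> S T" and c': "c' \<in> mor \<C> S T"
    and eq: "c \<cdot> i = c' \<cdot> i" "c \<cdot> j = c' \<cdot> j"
  shows "c = c'"
proof -
  note B = biproductD[OF b]
  have "c = (c \<cdot> i) \<cdot> p \<oplus>\<^bsub>Hom \<C> S T\<^esub> (c \<cdot> j) \<cdot> q" if c: "c \<in> mor \<C> S T" for c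
    using comp_add[OF comp_mor[OF B(3,1)] comp_mor[OF B(4,2)] c] comp_assoc[OF B(3,1) c]
      comp_assoc[OF B(4,2) c] comp_ident[OF c] B(9) by simp
  from this[OF c] this[OF c'] show ?thesis
    using eq by metis
qed

lemma biproduct_eqI_pair:
  assumes b: "biproduct \<C> A B S i j p q" and c: "c \<in> mor \<C> T S" and c': "c' \<in> mor \<C> T S"
    and eq: "p \<cdot> c = p \<cdot> c'" "q \<cdot> c = q \<cdot> c'"
  shows "c = c'"
proof -
  note B = biproductD[OF b]
  have "c = i \<cdot> (p \<cdot> c) \<oplus>\<^bsub>Hom \<C> T S\<^esub> j \<cdot> (q \<cdot> c)" if c: "c \<in> mor \<C> T S" for c
    using add_comp[OF c comp_mor[OF B(3,1)] comp_mor[OF B(4,2)]] comp_assoc[OF c B(3,1)]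
      comp_assoc[OF c B(4,2)] ident_comp[OF c] B(9) by simp
  from this[OF c] this[OF c'] show ?thesis
    using eq by metis
qed

text \<open>Precomposition with \<open>g \<cdot> f\<close> is a composite of two surjections. This
  is the stability needed for ET4, as its epic counterpart is for the dual axiom.\<close>

lemma monic_wrt_comp:
  assumes f: "monic_wrt \<C> \<X> A B f" and g: "monic_wrt \<C> \<X> B C g"
  shows "monic_wrt \<C> \<X> A C (g \<cdot> f)"
proof -
  have fm: "f \<in> mor \<C> A B" and gm: "g \<in> mor \<C> B C"
    using f g unfolding monic_wrt_def by auto
  have "(\<lambda>u. u \<cdot> g \<cdot> f) ` mor \<C> C X = mor \<C> A X" if X: "X \<in> \<X>" for X
  proof -
    have "(\<lambda>u. u \<cdot> g \<cdot> f) ` mor \<C> C X = (\<lambda>u. u \<cdot> f) ` (\<lambda>u. u \<cdot> g) ` mor \<C> C X"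
      unfolding image_image using comp_assoc[OF fm gm] by (intro image_cong) simp_all
    then show ?thesis
      using f g X unfolding monic_wrt_def by simp
  qed
  then show ?thesis
    using comp_mor[OF fm gm] unfolding monic_wrt_def by blast
qed

lemma epic_wrt_comp:
  assumes f: "epic_wrt \<C> \<X> A B f" and g: "epic_wrt \<C> \<X> B C g"
  shows "epic_wrt \<C> \<X> A C (g \<cdot> f)"
proof -
  have fm: "f \<in> mor \<C> A B" and gm: "g \<in> mor \<C> B C"
    using f g unfolding epic_wrt_def by auto
  have "(\<lambda>u. (g \<cdot> f) \<cdot> u) ` mor \<C> X A = mor \<C> X C" if X: "X \<in> \<X>" for X
  proof -
    have "(\<lambda>u. (g \<cdot> f) \<cdot> u) ` mor \<C> X A = (\<lambda>u. g \<cdot> u) ` (\<lambda>u. f \<cdot> u) ` mor \<C> X A"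
      unfolding image_image using comp_assoc[OF _ fm gm] by (intro image_cong) simp_all
    then show ?thesis
      using f g X unfolding epic_wrt_def by simp
  qed
  then show ?thesis
    using comp_mor[OF fm gm] unfolding epic_wrt_def by blast
qed

end

section \<open>Triangulated categories\<close>

context triangulated_category
begin

section \<open>Shift, rotation and exactness of triangles\<close>

lemma sh_zero [simp]: "sh \<C> \<zero>\<^bsub>Hom \<C> A B\<^esub> = \<zero>\<^bsub>Hom \<C> (Sh \<C> A) (Sh \<C> B)\<^esub>"
proof -
  let ?z = "\<zero>\<^bsub>Hom \<C> A B\<^esub>"
  have "sh \<C> ?z \<oplus>\<^bsub>Hom \<C> (Sh \<C> A) (Sh \<C> B)\<^esub> sh \<C> ?z = sh \<C> ?z"
    using sh_add[of ?z A B ?z] by simp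
  then show ?thesis
    using sh_mor[of ?z A B] Hom.add.l_cancel_one zero_mor by blast
qed

lemma sh_uminus:
  assumes "f \<in> mor \<C> A B"
  shows "sh \<C> (\<ominus>\<^bsub>Hom \<C> A B\<^esub> f) = \<ominus>\<^bsub>Hom \<C> (Sh \<C> A) (Sh \<C> B)\<^esub> sh \<C> f"
proof -
  have m: "\<ominus>\<^bsub>Hom \<C> A B\<^esub> f \<in> mor \<C> A B"
    using assms by simp
  have "sh \<C> (\<ominus>\<^bsub>Hom \<C> A B\<^esub> f) \<oplus>\<^bsub>Hom \<C> (Sh \<C> A) (Sh \<C> B)\<^esub> sh \<C> f =
        \<zero>\<^bsub>Hom \<C> (Sh \<C> A) (Sh \<C> B)\<^esub>"
    using sh_add[OF m assms] Hom.l_neg[OF assms] by simp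
  then show ?thesis
    using Hom.minus_equality sh_mor[OF m] sh_mor[OF assms] by metis
qed

lemma sh_full:
  assumes "f \<in> mor \<C> (Sh \<C> A) (Sh \<C> B)"
  obtains f' where "f' \<in> mor \<C> A B" "f = sh \<C> f'"
  using assms sh_fully_faithful[of A B] unfolding bij_betw_def by blast

lemma sh_inject: "\<lbrakk>f \<in> mor \<C> A B; f' \<in> mor \<C> A B; sh \<C> f = sh \<C> f'\<rbrakk> \<Longrightarrow> f = f'"
  using sh_fully_faithful[of A B] unfolding bij_betw_def inj_on_def by blast

lemma uminus_inject:
  "\<lbrakk>f \<in> mor \<C> A B; f' \<in> mor \<C> A B; \<ominus>\<^bsub>Hom \<C> A B\<^esub> f = \<ominus>\<^bsub>Hom \<C> A B\<^esub> f'\<rbrakk> \<Longrightarrow> f = f'"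
  using Hom.minus_minus by metis

lemma zero_object_Sh:
  assumes "zero_object \<C> Z"
  shows "zero_object \<C> (Sh \<C> Z)"
proof (rule zero_objectI)
  have "ident \<C> Z = \<zero>\<^bsub>Hom \<C> Z Z\<^esub>"
    using assms ident_mor[of Z] unfolding zero_object_def by blast
  then show "ident \<C> (Sh \<C> Z) = \<zero>\<^bsub>Hom \<C> (Sh \<C> Z) (Sh \<C> Z)\<^esub>"
    using sh_ident[of Z] by simp
qed

lemma Tri_morD:
  assumes "(A, f, B, g, C, h) \<in> Tri \<C>"
  shows "f \<in> mor \<C> A B" "g \<in> mor \<C> B C" "h \<in> mor \<C> C (Sh \<C> A)"
  using Tri_mor[OF assms] by auto

lemma Tri_rotate:
  assumes "(A, f, B, g, C, h) \<in> Tri \<C>"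
  shows "(B, g, C, h, Sh \<C> A, \<ominus>\<^bsub>Hom \<C> (Sh \<C> A) (Sh \<C> B)\<^esub> sh \<C> f) \<in> Tri \<C>"
  using assms TR2[of f A B g C h] Tri_mor[OF assms] by simp

text \<open>Each of the three rotations contributes one sign. Read from right to left, the
  equivalence unshifts a triangle whose objects are all shifts, which stands in for an inverse
  shift.\<close>

lemma Tri_rotate3:
  assumes "f \<in> mor \<C> A B" "g \<in> mor \<C> B C" "h \<in> mor \<C> C (Sh \<C> A)"
  shows "(A, f, B, g, C, h) \<in> Tri \<C> \<longleftrightarrow>
    (Sh \<C> A, \<ominus>\<^bsub>Hom \<C> (Sh \<C> A) (Sh \<C> B)\<^esub> sh \<C> f, Sh \<C> B,
     \<ominus>\<^bsub>Hom \<C> (Sh \<C> B) (Sh \<C> C)\<^esub> sh \<C> g, Sh \<C> C,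
     \<ominus>\<^bsub>Hom \<C> (Sh \<C> C) (Sh \<C> (Sh \<C> A))\<^esub> sh \<C> h) \<in> Tri \<C>"
proof -
  have "\<ominus>\<^bsub>Hom \<C> (Sh \<C> A) (Sh \<C> B)\<^esub> sh \<C> f \<in> mor \<C> (Sh \<C> A) (Sh \<C> B)"
    "\<ominus>\<^bsub>Hom \<C> (Sh \<C> B) (Sh \<C> C)\<^esub> sh \<C> g \<in> mor \<C> (Sh \<C> B) (Sh \<C> C)"
    using assms sh_mor by simp_all
  then show ?thesis
    using TR2 assms by metis
qed

text \<open>TR3, applied to the trivial triangle on \<open>A\<close> with the identity of
  \<open>A\<close> and \<open>f\<close> as first two components, makes \<open>g \<cdot> f\<close>
  factor through a zero object.\<close>

lemma Tri_comp_zero: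
  assumes t: "(A, f, B, g, C, h) \<in> Tri \<C>"
  shows "g \<cdot> f = \<zero>\<^bsub>Hom \<C> A C\<^esub>"
proof -
  note m = Tri_morD[OF t]
  obtain Z where "zero_object \<C> Z"
    using zero_object_exists by blast
  from TR3[OF TR1_ident[OF this] t ident_mor _ refl] m obtain c where
    "c \<in> mor \<C> Z C" "c \<cdot> \<zero>\<^bsub>Hom \<C> A Z\<^esub> = g \<cdot> f"
    by blast
  then show ?thesis
    by simp
qed

lemma Tri_comp_zero_sh:
  assumes t: "(A, f, B, g, C, h) \<in> Tri \<C>"
  shows "sh \<C> f \<cdot> h = \<zero>\<^bsub>Hom \<C> C (Sh \<C> B)\<^esub>"
proof -
  note m = Tri_morD[OF t]
  have "\<ominus>\<^bsub>Hom \<C> C (Sh \<C> B)\<^esub> (sh \<C> f \<cdot> h) = \<zero>\<^bsub>Hom \<C> C (Sh \<C> B)\<^esub>"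
    using Tri_comp_zero[OF Tri_rotate[OF Tri_rotate[OF t]]] m sh_mor[of f A B]
    by (simp add: uminus_comp[of h C "Sh \<C> A"])
  then show ?thesis
    using m sh_mor comp_mor Hom.add.inv_eq_1_iff by meson
qed

text \<open>TR3 only produces third components. Rotating the given triangle and the trivial triangle
  on \<open>T\<close> once moves the wanted morphism to that place, where it appears shifted;
  fullness unshifts it, and the signs on the two sides cancel.\<close>

lemma Tri_lift:
  assumes t: "(A, f, B, g, C, h) \<in> Tri \<C>" and u: "u \<in> mor \<C> T B" "g \<cdot> u = \<zero>\<^bsub>Hom \<C> T C\<^esub>"
  shows "\<exists>w\<in>mor \<C> T A. u = f \<cdot> w"
proof -
  note m = Tri_morD[OF t]
  obtain Z where "zero_object \<C> Z"
    using zero_object_exists by blast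
  note tz = TR1_ident[OF this, of T]
  have "\<zero>\<^bsub>Hom \<C> Z C\<^esub> \<cdot> \<zero>\<^bsub>Hom \<C> T Z\<^esub> = g \<cdot> u"
    using u by simp
  from TR3[OF Tri_rotate[OF tz] Tri_rotate[OF t] u(1) zero_mor this] obtain c where
    c: "c \<in> mor \<C> (Sh \<C> T) (Sh \<C> A)"
    "sh \<C> u \<cdot> (\<ominus>\<^bsub>Hom \<C> (Sh \<C> T) (Sh \<C> T)\<^esub> sh \<C> (ident \<C> T)) =
     (\<ominus>\<^bsub>Hom \<C> (Sh \<C> A) (Sh \<C> B)\<^esub> sh \<C> f) \<cdot> c"
    by blast
  obtain w where w: "w \<in> mor \<C> T A" "c = sh \<C> w"
    using c sh_full by metis
  have fw: "f \<cdot> w \<in> mor \<C> T B"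
    using m w comp_mor by blast
  have s: "sh \<C> f \<in> mor \<C> (Sh \<C> A) (Sh \<C> B)" "sh \<C> u \<in> mor \<C> (Sh \<C> T) (Sh \<C> B)"
    using sh_mor m u by blast+
  have "\<ominus>\<^bsub>Hom \<C> (Sh \<C> T) (Sh \<C> B)\<^esub> sh \<C> u = \<ominus>\<^bsub>Hom \<C> (Sh \<C> T) (Sh \<C> B)\<^esub> sh \<C> (f \<cdot> w)"
    using c s w m ident_mor[of "Sh \<C> T"]
    by (simp add: comp_uminus[of _ "Sh \<C> T" "Sh \<C> T"] uminus_comp[of _ "Sh \<C> T"]
        sh_ident comp_ident[of _ "Sh \<C> T" "Sh \<C> B"] sh_comp[of w T A f B])
  then have "sh \<C> u = sh \<C> (f \<cdot> w)"
    using uminus_inject s sh_mor[OF fw] by blast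
  then show ?thesis
    using sh_inject u fw w by blast
qed

text \<open>The trivial triangle that ends in \<open>Sh Z\<close>, which is again a zero object, is
  rotated backwards; this is possible since TR2 is an equivalence.\<close>

lemma Tri_zero_ident:
  assumes Z: "zero_object \<C> Z"
  shows "(Z, \<zero>\<^bsub>Hom \<C> Z T\<^esub>, T, ident \<C> T, T, \<zero>\<^bsub>Hom \<C> T (Sh \<C> Z)\<^esub>) \<in> Tri \<C>"
  using TR1_ident[OF zero_object_Sh[OF Z], of T] TR2[of "\<zero>\<^bsub>Hom \<C> Z T\<^esub>" Z T "ident \<C> T" T]
  by (simp add: ident_mor)

text \<open>The triangle from \<open>Z\<close> through the identity of \<open>T\<close> is the
  target of TR3; the third component of the resulting morphism is the extension.\<close>

lemma Tri_extend:
  assumes t: "(A, f, B, g, C, h) \<in> Tri \<C>" and u: "u \<in> mor \<C> B T" "u \<cdot> f = \<zero>\<^bsub>Hom \<C> A T\<^esub>"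
  shows "\<exists>w\<in>mor \<C> C T. u = w \<cdot> g"
proof -
  note m = Tri_morD[OF t]
  obtain Z where Z: "zero_object \<C> Z"
    using zero_object_exists by blast
  have "u \<cdot> f = \<zero>\<^bsub>Hom \<C> Z T\<^esub> \<cdot> \<zero>\<^bsub>Hom \<C> A Z\<^esub>"
    using u by simp
  from TR3[OF t Tri_zero_ident[OF Z] zero_mor u(1) this] show ?thesis
    using u by (auto simp: ident_comp)
qed

lemma Tri_extend_sh:
  assumes t: "(A, f, B, g, C, h) \<in> Tri \<C>" and u: "u \<in> mor \<C> A T"
    "sh \<C> u \<cdot> h = \<zero>\<^bsub>Hom \<C> C (Sh \<C> T)\<^esub>"
  shows "\<exists>w\<in>mor \<C> B T. u = w \<cdot> f"
proof -
  note m = Tri_morD[OF t]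
  obtain v where v: "v \<in> mor \<C> (Sh \<C> B) (Sh \<C> T)"
    "sh \<C> u = v \<cdot> (\<ominus>\<^bsub>Hom \<C> (Sh \<C> A) (Sh \<C> B)\<^esub> sh \<C> f)"
    using Tri_extend[OF Tri_rotate[OF Tri_rotate[OF t]] sh_mor[OF u(1)] u(2)] by blast
  obtain w where w: "w \<in> mor \<C> B T" "v = sh \<C> w"
    using v sh_full by metis
  \<comment> \<open>After two rotations the second morphism is \<open>- sh f\<close>; the sign is
    absorbed into the extension.\<close>
  let ?w = "\<ominus>\<^bsub>Hom \<C> B T\<^esub> w"
  have wm: "?w \<in> mor \<C> B T"
    using w by simp
  have "sh \<C> u = sh \<C> (?w \<cdot> f)"
    using v w m sh_mor[of f A B] comp_mor[of f A B w T]
    by (simp add: comp_uminus[of _ "Sh \<C> A" "Sh \<C> B"] uminus_comp[of _ A B] sh_uminus sh_comp[of f A B])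
  then show ?thesis
    using sh_inject[OF u(1) comp_mor[of f A B ?w T]] m wm by blast
qed

section \<open>Completing a morphism in the third or second position\<close>

text \<open>TR1 gives a cone \<open>D\<close> of \<open>\<delta>\<close>. Essential surjectivity
  replaces \<open>D\<close> by some \<open>Sh B\<close>, and the result has the shape of a twice
  rotated triangle once its remaining morphisms are written as negatives of shifts.\<close>

lemma Tri_exists_third:
  assumes d: "\<delta> \<in> mor \<C> C (Sh \<C> A)"
  obtains f B g where "(A, f, B, g, C, \<delta>) \<in> Tri \<C>"
proof -
  obtain D g' h' where t: "(C, \<delta>, Sh \<C> A, g', D, h') \<in> Tri \<C>"
    using TR1_cone[OF d] by blast
  note m = Tri_morD[OF t]
  obtain B \<phi> where "is_iso \<C> (Sh \<C> B) D \<phi>"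
    using Sh_essentially_surjective[of D] unfolding isomorphic_def by blast
  then obtain \<psi> where \<phi>: "\<phi> \<in> mor \<C> (Sh \<C> B) D" "\<psi> \<in> mor \<C> D (Sh \<C> B)"
    "\<psi> \<cdot> \<phi> = ident \<C> (Sh \<C> B)" "\<phi> \<cdot> \<psi> = ident \<C> D"
    unfolding is_iso_def by blast
  have iso: "is_iso \<C> D (Sh \<C> B) \<psi>"
    using \<phi> unfolding is_iso_def by blast
  have m': "\<psi> \<cdot> g' \<in> mor \<C> (Sh \<C> A) (Sh \<C> B)" "h' \<cdot> \<phi> \<in> mor \<C> (Sh \<C> B) (Sh \<C> C)"
    using m \<phi> comp_mor by blast+
  have "ident \<C> (Sh \<C> A) \<cdot> \<delta> = \<delta> \<cdot> ident \<C> C" "\<psi> \<cdot> g' = (\<psi> \<cdot> g') \<cdot> ident \<C> (Sh \<C> A)"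
    "sh \<C> (ident \<C> C) \<cdot> h' = (h' \<cdot> \<phi>) \<cdot> \<psi>"
    using comp_assoc[OF \<phi>(2,1) m(3)] \<phi>(4)
    by (simp_all add: ident_comp[OF d] comp_ident[OF d] comp_ident[OF m'(1)] ident_comp[OF m(3)]
        comp_ident[OF m(3)] sh_ident)
  then have t': "(C, \<delta>, Sh \<C> A, \<psi> \<cdot> g', Sh \<C> B, h' \<cdot> \<phi>) \<in> Tri \<C>"
    using TR1_iso[OF t d m' is_iso_ident is_iso_ident iso] by blast
  \<comment> \<open>\<open>f\<close> and \<open>g\<close> are unshifted from the negatives, because
    a triangle rotated twice contains \<open>- sh f\<close> and \<open>- sh g\<close>.\<close>
  obtain f where f: "f \<in> mor \<C> A B" "\<ominus>\<^bsub>Hom \<C> (Sh \<C> A) (Sh \<C> B)\<^esub> (\<psi> \<cdot> g') = sh \<C> f"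
    using m' sh_full[of "\<ominus>\<^bsub>Hom \<C> (Sh \<C> A) (Sh \<C> B)\<^esub> (\<psi> \<cdot> g')"] by (metis Hom.a_inv_closed)
  obtain g where g: "g \<in> mor \<C> B C" "\<ominus>\<^bsub>Hom \<C> (Sh \<C> B) (Sh \<C> C)\<^esub> (h' \<cdot> \<phi>) = sh \<C> g"
    using m' sh_full[of "\<ominus>\<^bsub>Hom \<C> (Sh \<C> B) (Sh \<C> C)\<^esub> (h' \<cdot> \<phi>)"] by (metis Hom.a_inv_closed)
  have "(C, \<delta>, Sh \<C> A, \<ominus>\<^bsub>Hom \<C> (Sh \<C> A) (Sh \<C> B)\<^esub> sh \<C> f, Sh \<C> B,
      \<ominus>\<^bsub>Hom \<C> (Sh \<C> B) (Sh \<C> C)\<^esub> sh \<C> g) \<in> Tri \<C>"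
    using t' m' f(2)[symmetric] g(2)[symmetric] by (simp add: Hom.minus_minus)
  then have "(A, f, B, g, C, \<delta>) \<in> Tri \<C>"
    using TR2[OF f(1) g(1) d] TR2[OF g(1) d Tri_mor[THEN conjunct2, THEN conjunct1]] by metis
  then show ?thesis
    by (rule that)
qed

lemma Tri_exists_second:
  assumes g: "g \<in> mor \<C> B C"
  obtains A f h where "(A, f, B, g, C, h) \<in> Tri \<C>"
proof -
  obtain D h' k where t: "(B, g, C, h', D, k) \<in> Tri \<C>"
    using TR1_cone[OF g] by blast
  note m = Tri_morD[OF t]
  obtain A \<phi> where "is_iso \<C> (Sh \<C> A) D \<phi>"
    using Sh_essentially_surjective[of D] unfolding isomorphic_def by blast
  then obtain \<psi> where \<phi>: "\<phi> \<in> mor \<C> (Sh \<C> A) D" "\<psi> \<in> mor \<C> D (Sh \<C> A)"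
    "\<psi> \<cdot> \<phi> = ident \<C> (Sh \<C> A)" "\<phi> \<cdot> \<psi> = ident \<C> D"
    unfolding is_iso_def by blast
  have iso: "is_iso \<C> D (Sh \<C> A) \<psi>"
    using \<phi> unfolding is_iso_def by blast
  have m': "\<psi> \<cdot> h' \<in> mor \<C> C (Sh \<C> A)" "k \<cdot> \<phi> \<in> mor \<C> (Sh \<C> A) (Sh \<C> B)"
    using m \<phi> comp_mor by blast+
  have "ident \<C> C \<cdot> g = g \<cdot> ident \<C> B" "\<psi> \<cdot> h' = (\<psi> \<cdot> h') \<cdot> ident \<C> C"
    "sh \<C> (ident \<C> B) \<cdot> k = (k \<cdot> \<phi>) \<cdot> \<psi>"
    using comp_assoc[OF \<phi>(2,1) m(3)] \<phi>(4)
    by (simp_all add: ident_comp[OF g] comp_ident[OF g] comp_ident[OF m'(1)] ident_comp[OF m(3)]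
        comp_ident[OF m(3)] sh_ident)
  then have t': "(B, g, C, \<psi> \<cdot> h', Sh \<C> A, k \<cdot> \<phi>) \<in> Tri \<C>"
    using TR1_iso[OF t g m' is_iso_ident is_iso_ident iso] by blast
  obtain f where f: "f \<in> mor \<C> A B" "\<ominus>\<^bsub>Hom \<C> (Sh \<C> A) (Sh \<C> B)\<^esub> (k \<cdot> \<phi>) = sh \<C> f"
    using m' sh_full[of "\<ominus>\<^bsub>Hom \<C> (Sh \<C> A) (Sh \<C> B)\<^esub> (k \<cdot> \<phi>)"] by (metis Hom.a_inv_closed)
  have "(A, f, B, g, C, \<psi> \<cdot> h') \<in> Tri \<C>"
    using t' m' f(2)[symmetric] TR2[OF f(1) g m'(1)] by (simp add: Hom.minus_minus)
  then show ?thesis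
    by (rule that)
qed

section \<open>Morphisms of triangles and uniqueness of realizations\<close>

text \<open>In the twice rotated triangles \<open>c\<close> and \<open>sh a\<close> are the first
  two components and \<open>eq\<close> is the square required by TR3, so the third component is the
  shift of the wanted \<open>b\<close>. This becomes the lifting of morphisms of extensions, and
  comparing two triangles on the same \<open>\<delta>\<close> rests on it.\<close>

lemma Tri_morphism_middle:
  assumes t: "(A, x, B, y, C, \<delta>) \<in> Tri \<C>" and t': "(A', x', B', y', C', \<delta>') \<in> Tri \<C>"
    and a: "a \<in> mor \<C> A A'" and c: "c \<in> mor \<C> C C'" and eq: "sh \<C> a \<cdot> \<delta> = \<delta>' \<cdot> c"
  shows "\<exists>b\<in>mor \<C> B B'. b \<cdot> x = x' \<cdot> a \<and> y' \<cdot> b = c \<cdot> y"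
proof -
  note m = Tri_morD[OF t] Tri_morD[OF t']
  have "\<exists>b\<in>mor \<C> (Sh \<C> B) (Sh \<C> B').
      b \<cdot> (\<ominus>\<^bsub>Hom \<C> (Sh \<C> A) (Sh \<C> B)\<^esub> sh \<C> x) = (\<ominus>\<^bsub>Hom \<C> (Sh \<C> A') (Sh \<C> B')\<^esub> sh \<C> x') \<cdot> sh \<C> a \<and>
      sh \<C> c \<cdot> (\<ominus>\<^bsub>Hom \<C> (Sh \<C> B) (Sh \<C> C)\<^esub> sh \<C> y) = (\<ominus>\<^bsub>Hom \<C> (Sh \<C> B') (Sh \<C> C')\<^esub> sh \<C> y') \<cdot> b"
    by (rule TR3[OF Tri_rotate[OF Tri_rotate[OF t]] Tri_rotate[OF Tri_rotate[OF t']] c sh_mor[OF a] eq])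
  then obtain b where b: "b \<in> mor \<C> B B'"
    "sh \<C> b \<cdot> (\<ominus>\<^bsub>Hom \<C> (Sh \<C> A) (Sh \<C> B)\<^esub> sh \<C> x) = (\<ominus>\<^bsub>Hom \<C> (Sh \<C> A') (Sh \<C> B')\<^esub> sh \<C> x') \<cdot> sh \<C> a"
    "sh \<C> c \<cdot> (\<ominus>\<^bsub>Hom \<C> (Sh \<C> B) (Sh \<C> C)\<^esub> sh \<C> y) = (\<ominus>\<^bsub>Hom \<C> (Sh \<C> B') (Sh \<C> C')\<^esub> sh \<C> y') \<cdot> sh \<C> b"
    using sh_full by metis
  have s: "sh \<C> a \<in> mor \<C> (Sh \<C> A) (Sh \<C> A')" "sh \<C> b \<in> mor \<C> (Sh \<C> B) (Sh \<C> B')"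
    "sh \<C> c \<in> mor \<C> (Sh \<C> C) (Sh \<C> C')" "sh \<C> x \<in> mor \<C> (Sh \<C> A) (Sh \<C> B)"
    "sh \<C> y \<in> mor \<C> (Sh \<C> B) (Sh \<C> C)" "sh \<C> x' \<in> mor \<C> (Sh \<C> A') (Sh \<C> B')"
    "sh \<C> y' \<in> mor \<C> (Sh \<C> B') (Sh \<C> C')"
    using sh_mor m a b c by blast+
  have mm: "b \<cdot> x \<in> mor \<C> A B'" "x' \<cdot> a \<in> mor \<C> A B'" "c \<cdot> y \<in> mor \<C> B C'" "y' \<cdot> b \<in> mor \<C> B C'"
    using m a b c comp_mor by blast+
  have "\<ominus>\<^bsub>Hom \<C> (Sh \<C> A) (Sh \<C> B')\<^esub> sh \<C> (b \<cdot> x) = \<ominus>\<^bsub>Hom \<C> (Sh \<C> A) (Sh \<C> B')\<^esub> sh \<C> (x' \<cdot> a)"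
    using b(2) comp_uminus[OF s(4,2)] uminus_comp[OF s(1,6)] sh_comp[of x A B b B'] sh_comp[of a A A' x' B']
      m a b(1) by simp
  then have "b \<cdot> x = x' \<cdot> a"
    using uminus_inject sh_inject sh_mor mm by meson
  moreover have "\<ominus>\<^bsub>Hom \<C> (Sh \<C> B) (Sh \<C> C')\<^esub> sh \<C> (c \<cdot> y) = \<ominus>\<^bsub>Hom \<C> (Sh \<C> B) (Sh \<C> C')\<^esub> sh \<C> (y' \<cdot> b)"
    using b(3) comp_uminus[OF s(5,3)] uminus_comp[OF s(2,7)] sh_comp[of y B C c C'] sh_comp[of b B B' y' C']
      m c b(1) by simp
  then have "c \<cdot> y = y' \<cdot> b"
    using uminus_inject sh_inject sh_mor mm by meson
  ultimately show ?thesis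
    using b(1) by metis
qed

text \<open>One rotation puts \<open>b\<close> and \<open>c\<close> in the places where TR3 accepts
  them, and the third component is the shift of \<open>a\<close>.\<close>

lemma Tri_morphism_first:
  assumes t: "(A, x, B, y, C, \<delta>) \<in> Tri \<C>" and t': "(A', x', B', y', C', \<delta>') \<in> Tri \<C>"
    and b: "b \<in> mor \<C> B B'" and c: "c \<in> mor \<C> C C'" and eq: "c \<cdot> y = y' \<cdot> b"
  shows "\<exists>a\<in>mor \<C> A A'. sh \<C> a \<cdot> \<delta> = \<delta>' \<cdot> c \<and> b \<cdot> x = x' \<cdot> a"
proof -
  note m = Tri_morD[OF t] Tri_morD[OF t']
  have "\<exists>a\<in>mor \<C> (Sh \<C> A) (Sh \<C> A'). a \<cdot> \<delta> = \<delta>' \<cdot> c \<and>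
      sh \<C> b \<cdot> (\<ominus>\<^bsub>Hom \<C> (Sh \<C> A) (Sh \<C> B)\<^esub> sh \<C> x) = (\<ominus>\<^bsub>Hom \<C> (Sh \<C> A') (Sh \<C> B')\<^esub> sh \<C> x') \<cdot> a"
    by (rule TR3[OF Tri_rotate[OF t] Tri_rotate[OF t'] b c eq])
  then obtain a where a: "a \<in> mor \<C> A A'" "sh \<C> a \<cdot> \<delta> = \<delta>' \<cdot> c"
    "sh \<C> b \<cdot> (\<ominus>\<^bsub>Hom \<C> (Sh \<C> A) (Sh \<C> B)\<^esub> sh \<C> x) = (\<ominus>\<^bsub>Hom \<C> (Sh \<C> A') (Sh \<C> B')\<^esub> sh \<C> x') \<cdot> sh \<C> a"
    using sh_full by metis
  have s: "sh \<C> a \<in> mor \<C> (Sh \<C> A) (Sh \<C> A')" "sh \<C> b \<in> mor \<C> (Sh \<C> B) (Sh \<C> B')"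
    "sh \<C> x \<in> mor \<C> (Sh \<C> A) (Sh \<C> B)" "sh \<C> x' \<in> mor \<C> (Sh \<C> A') (Sh \<C> B')"
    using sh_mor m a b by blast+
  have mm: "b \<cdot> x \<in> mor \<C> A B'" "x' \<cdot> a \<in> mor \<C> A B'"
    using m a b comp_mor by blast+
  have "\<ominus>\<^bsub>Hom \<C> (Sh \<C> A) (Sh \<C> B')\<^esub> sh \<C> (b \<cdot> x) = \<ominus>\<^bsub>Hom \<C> (Sh \<C> A) (Sh \<C> B')\<^esub> sh \<C> (x' \<cdot> a)"
    using a(3) comp_uminus[OF s(3,2)] uminus_comp[OF s(1,4)] sh_comp[of x A B b B'] sh_comp[of a A A' x' B']
      m a(1) b by simp
  then have "b \<cdot> x = x' \<cdot> a"
    using uminus_inject sh_inject sh_mor mm by meson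
  then show ?thesis
    using a by blast
qed

text \<open>This replaces the five lemma when the sequence through \<open>N\<close> is not yet known
  to be a triangle. Its only exactness is \<open>ker\<close>; the matching property on the side of
  \<open>M\<close> is \<open>Tri_lift\<close>. Both \<open>c \<cdot> b\<close> and
  \<open>b \<cdot> c\<close> fix the outer morphisms and are therefore isomorphisms by
  \<open>is_iso_endo\<close>, so \<open>b\<close> is one as well, and TR1 carries the triangle
  over.\<close>

lemma Tri_transfer:
  assumes t: "(A, x, M, y, C, \<delta>) \<in> Tri \<C>" and x': "x' \<in> mor \<C> A N" and y': "y' \<in> mor \<C> N C"
    and b: "b \<in> mor \<C> M N" "b \<cdot> x = x'" "y' \<cdot> b = y"
    and c: "c \<in> mor \<C> N M" "c \<cdot> x' = x" "y \<cdot> c = y'"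
    and ker: "\<And>n. n \<in> mor \<C> N N \<Longrightarrow> y' \<cdot> n = \<zero>\<^bsub>Hom \<C> N C\<^esub> \<Longrightarrow> \<exists>w\<in>mor \<C> N A. n = x' \<cdot> w"
  shows "is_iso \<C> M N b" "(A, x', N, y', C, \<delta>) \<in> Tri \<C>"
proof -
  note m = Tri_morD[OF t]
  have mm: "c \<cdot> b \<in> mor \<C> M M" "b \<cdot> c \<in> mor \<C> N N"
    using b c comp_mor by blast+
  have xM: "x \<in> mor \<C> A M" and yM: "y \<in> mor \<C> M C" and \<delta>: "\<delta> \<in> mor \<C> C (Sh \<C> A)"
    using m by auto
  have "(c \<cdot> b) \<cdot> x = x" "y \<cdot> (c \<cdot> b) = y" "(b \<cdot> c) \<cdot> x' = x'" "y' \<cdot> (b \<cdot> c) = y'"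
    using comp_assoc[OF xM b(1) c(1)] comp_assoc[OF b(1) c(1) yM]
      comp_assoc[OF x' c(1) b(1)] comp_assoc[OF c(1) b(1) y'] b c by simp_all
  then have "is_iso \<C> M M (c \<cdot> b)" "is_iso \<C> N N (b \<cdot> c)"
    using is_iso_endo[OF xM yM mm(1)] Tri_lift[OF t] is_iso_endo[OF x' y' mm(2)] ker by blast+
  then show *: "is_iso \<C> M N b"
    using is_iso_if_compositions[OF b(1) c(1)] by blast
  show "(A, x', N, y', C, \<delta>) \<in> Tri \<C>"
    by (rule TR1_iso[OF t x' y' \<delta> is_iso_ident * is_iso_ident])
      (use b x' yM \<delta> in \<open>simp_all add: comp_ident ident_comp sh_ident\<close>)
qed

text \<open>Closure of triangles under isomorphism gives one inclusion. For the other, two triangles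
  on the same \<open>\<delta>\<close> are compared in both directions and
  \<open>Tri_transfer\<close> shows that the comparison is invertible. Hence the union defining
  \<open>rel_real\<close> is a single equivalence class.\<close>

lemma seq_class_Tri:
  assumes t: "(A, x, B, y, C, \<delta>) \<in> Tri \<C>"
  shows "seq_class \<C> A C (x, B, y) = {(x', B', y'). (A, x', B', y', C, \<delta>) \<in> Tri \<C>}"
proof -
  note m = Tri_morD[OF t]
  have "(A, x', B', y', C, \<delta>) \<in> Tri \<C>"
    if "x' \<in> mor \<C> A B'" "y' \<in> mor \<C> B' C" "is_iso \<C> B B' b" "b \<cdot> x = x'" "y' \<cdot> b = y" for x' B' y' b
    using m by (intro TR1_iso[OF t that(1,2) _ is_iso_ident that(3) is_iso_ident])
      (use that m in \<open>auto simp: comp_ident ident_comp sh_ident\<close>)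
  moreover have "\<exists>b. is_iso \<C> B B' b \<and> b \<cdot> x = x' \<and> y' \<cdot> b = y"
    if t': "(A, x', B', y', C, \<delta>) \<in> Tri \<C>" for x' B' y'
  proof -
    note m' = Tri_morD[OF t']
    have "sh \<C> (ident \<C> A) \<cdot> \<delta> = \<delta> \<cdot> ident \<C> C"
      using m by (simp add: sh_ident ident_comp[OF m(3)] comp_ident[OF m(3)])
    from Tri_morphism_middle[OF t t' ident_mor ident_mor this]
      Tri_morphism_middle[OF t' t ident_mor ident_mor this]
    obtain b c where b: "b \<in> mor \<C> B B'" "b \<cdot> x = x'" "y' \<cdot> b = y"
      and c: "c \<in> mor \<C> B' B" "c \<cdot> x' = x" "y \<cdot> c = y'"
      using m m' by (auto simp: ident_comp comp_ident)
    then show ?thesis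
      using Tri_transfer(1)[OF t _ _ b c] Tri_lift[OF t'] m' by blast
  qed
  ultimately show ?thesis
    using Tri_mor unfolding seq_class_def by (auto 0 4)
qed

lemma rel_real_Tri: "rel_real \<C> C A \<delta> = {(x, B, y). (A, x, B, y, C, \<delta>) \<in> Tri \<C>}"
  unfolding rel_real_def using seq_class_Tri by fastforce

section \<open>Split triangles and direct sums of triangles\<close>

lemma Tri_split:
  assumes t: "(A, f, B, g, C, \<zero>\<^bsub>Hom \<C> C (Sh \<C> A)\<^esub>) \<in> Tri \<C>"
  obtains r s where "biproduct \<C> A C B f s r g"
proof -
  note m = Tri_morD[OF t]
  obtain r where r: "r \<in> mor \<C> B A" "r \<cdot> f = ident \<C> A"
    using Tri_extend_sh[OF t ident_mor] sh_mor[OF ident_mor[of A]] by auto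
  obtain s where s: "s \<in> mor \<C> C B" "g \<cdot> s = ident \<C> C"
    using Tri_lift[OF Tri_rotate[OF t] ident_mor] ident_mor[of C] by auto
  let ?H = "Hom \<C> B B"
  \<comment> \<open>The composite \<open>r \<cdot> s\<close> may be nonzero, so \<open>r\<close> is
    not yet the projection of a biproduct. The complement \<open>e\<close> of the idempotent
    \<open>s \<cdot> g\<close> is killed by \<open>g\<close>, hence equals some
    \<open>f \<cdot> w\<close>, and \<open>w\<close> is the correct projection.\<close>
  define e where "e = ident \<C> B \<oplus>\<^bsub>?H\<^esub> \<ominus>\<^bsub>?H\<^esub> (s \<cdot> g)"
  have sg: "s \<cdot> g \<in> mor \<C> B B" and nsg: "\<ominus>\<^bsub>?H\<^esub> (s \<cdot> g) \<in> mor \<C> B B"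
    using s m comp_mor Hom.a_inv_closed by blast+
  have e: "e \<in> mor \<C> B B"
    unfolding e_def using nsg ident_mor by simp
  have ge: "g \<cdot> e = \<zero>\<^bsub>Hom \<C> B C\<^esub>"
    unfolding e_def using comp_add[OF ident_mor nsg m(2)] comp_assoc[OF m(2) s(1) m(2)] s m(2)
    by (simp add: comp_uminus[OF sg] comp_ident ident_comp Hom.r_neg)
  have ef: "e \<cdot> f = f"
    unfolding e_def using add_comp[OF m(1) ident_mor nsg] comp_assoc[OF m(1,2) s(1)] s m(1)
    by (simp add: uminus_comp[OF m(1) sg] Tri_comp_zero[OF t] ident_comp)
  have es: "e \<cdot> s = \<zero>\<^bsub>Hom \<C> C B\<^esub>"
    unfolding e_def using add_comp[OF s(1) ident_mor nsg] comp_assoc[OF s(1) m(2) s(1)] s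
    by (simp add: uminus_comp[OF s(1) sg] comp_ident ident_comp Hom.r_neg)
  obtain w where w: "w \<in> mor \<C> B A" "e = f \<cdot> w"
    using Tri_lift[OF t e ge] by blast
  \<comment> \<open>The uncorrected \<open>r\<close> still cancels \<open>f\<close> from the left,
    which turns \<open>e \<cdot> f = f\<close> and \<open>e \<cdot> s = 0\<close> into the equations
    for \<open>w\<close>.\<close>
  have mono: "r \<cdot> (f \<cdot> u) = u" if "u \<in> mor \<C> T A" for u T
    using comp_assoc[OF that m(1) r(1)] r that by (simp add: ident_comp)
  have "w \<cdot> f = ident \<C> A"
    using mono[OF comp_mor[OF m(1) w(1)]] comp_assoc[OF m(1) w(1) m(1)] ef w r by simp
  moreover have "w \<cdot> s = \<zero>\<^bsub>Hom \<C> C A\<^esub>"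
    using mono[OF comp_mor[OF s(1) w(1)]] comp_assoc[OF s(1) w(1) m(1)] es w r by simp
  moreover have "f \<cdot> w \<oplus>\<^bsub>?H\<^esub> s \<cdot> g = ident \<C> B"
    using sg nsg ident_mor[of B] unfolding w(2)[symmetric] e_def
    by (simp add: Hom.a_assoc Hom.l_neg)
  ultimately have "biproduct \<C> A C B f s w g"
    using m w s Tri_comp_zero[OF t] unfolding biproduct_def by blast
  then show ?thesis
    by (rule that)
qed

text \<open>Some triangle has third morphism zero, and by \<open>Tri_split\<close> its middle term
  is a biproduct of the same two objects. The comparison of the two biproducts carries this triangle
  to the given sequence.\<close>

lemma Tri_biproduct:
  assumes b: "biproduct \<C> A C S i j p q"
  shows "(A, i, S, q, C, \<zero>\<^bsub>Hom \<C> C (Sh \<C> A)\<^esub>) \<in> Tri \<C>"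
proof -
  note B = biproductD[OF b]
  obtain f B g where t: "(A, f, B, g, C, \<zero>\<^bsub>Hom \<C> C (Sh \<C> A)\<^esub>) \<in> Tri \<C>"
    using Tri_exists_third[OF zero_mor] by blast
  obtain r s where b': "biproduct \<C> A C B f s r g"
    using Tri_split[OF t] by blast
  note B' = biproductD[OF b']
  obtain d where d: "d \<in> mor \<C> B S" "d \<cdot> f = i" "d \<cdot> s = j"
    using biproduct_copair[OF b' B(1,2)] by blast
  obtain c where c: "c \<in> mor \<C> S B" "c \<cdot> i = f" "c \<cdot> j = s"
    using biproduct_copair[OF b B'(1,2)] by blast
  have qd: "q \<cdot> d = g"
    using comp_assoc[OF B'(1) d(1) B(4)] comp_assoc[OF B'(2) d(1) B(4)] d B B'
    by (intro biproduct_eqI_copair[OF b' comp_mor[OF d(1) B(4)] B'(4)]) simp_all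
  have gc: "g \<cdot> c = q"
    using comp_assoc[OF B(1) c(1) B'(4)] comp_assoc[OF B(2) c(1) B'(4)] c B B'
    by (intro biproduct_eqI_copair[OF b comp_mor[OF c(1) B'(4)] B(4)]) simp_all
  have "\<exists>w\<in>mor \<C> S A. n = i \<cdot> w" if n: "n \<in> mor \<C> S S" "q \<cdot> n = \<zero>\<^bsub>Hom \<C> S C\<^esub>" for n
  proof
    show pn: "p \<cdot> n \<in> mor \<C> S A"
      using n B comp_mor by blast
    show "n = i \<cdot> (p \<cdot> n)"
      using comp_assoc[OF pn B(1,3)] comp_assoc[OF pn B(1,4)] n B(5,8)
      by (intro biproduct_eqI_pair[OF b n(1) comp_mor[OF pn B(1)]])
        (simp_all add: ident_comp[OF pn] zero_comp[OF pn])
  qed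
  from Tri_transfer(2)[OF t B(1,4) d(1,2) qd c(1,2) gc this] show ?thesis .
qed

text \<open>An arbitrary triangle on \<open>\<epsilon>\<close> is chosen and compared with the
  summand triangles: the injections of the ends give morphisms into its middle term
  \<open>N\<close>, the projections give morphisms out of it. Assembled over \<open>SB\<close>,
  these are the two comparisons that \<open>Tri_transfer\<close> needs.\<close>

lemma Tri_sum:
  assumes t: "(A, x, B, y, C, \<delta>) \<in> Tri \<C>" and t': "(A', x', B', y', C', \<delta>') \<in> Tri \<C>"
    and bA: "biproduct \<C> A A' SA iA jA pA qA" and bB: "biproduct \<C> B B' SB iB jB pB qB"
    and bC: "biproduct \<C> C C' SC iC jC pC qC"
    and X: "X \<in> mor \<C> SA SB" "X \<cdot> iA = iB \<cdot> x" "X \<cdot> jA = jB \<cdot> x'"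
    and Y: "Y \<in> mor \<C> SB SC" "Y \<cdot> iB = iC \<cdot> y" "Y \<cdot> jB = jC \<cdot> y'"
    and \<epsilon>: "\<epsilon> \<in> mor \<C> SC (Sh \<C> SA)" "\<epsilon> \<cdot> iC = sh \<C> iA \<cdot> \<delta>" "\<epsilon> \<cdot> jC = sh \<C> jA \<cdot> \<delta>'"
  shows "(SA, X, SB, Y, SC, \<epsilon>) \<in> Tri \<C>"
proof -
  \<comment> \<open>A block diagonal morphism is prescribed on the injections; the dual description
    by projections is derived once and used for \<open>X\<close>, \<open>Y\<close> and
    \<open>\<epsilon>\<close>.\<close>
  have proj: "p' \<cdot> Z = z \<cdot> p \<and> q' \<cdot> Z = z' \<cdot> q"
    if b: "biproduct \<C> M M' S i j p q" and b': "biproduct \<C> N N' S' i' j' p' q'"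
      and z: "z \<in> mor \<C> M N" "z' \<in> mor \<C> M' N'"
      and Z: "Z \<in> mor \<C> S S'" "Z \<cdot> i = i' \<cdot> z" "Z \<cdot> j = j' \<cdot> z'"
    for M M' S i j p q N N' S' i' j' p' q' z z' Z
  proof
    note b1 = biproductD[OF b] and b2 = biproductD[OF b']
    have "(p' \<cdot> Z) \<cdot> i = (z \<cdot> p) \<cdot> i" "(p' \<cdot> Z) \<cdot> j = (z \<cdot> p) \<cdot> j"
      "(q' \<cdot> Z) \<cdot> i = (z' \<cdot> q) \<cdot> i" "(q' \<cdot> Z) \<cdot> j = (z' \<cdot> q) \<cdot> j"
      using comp_assoc[OF b1(1) Z(1) b2(3)] comp_assoc[OF b1(2) Z(1) b2(3)]
        comp_assoc[OF b1(1) Z(1) b2(4)] comp_assoc[OF b1(2) Z(1) b2(4)]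
        comp_assoc[OF b1(1,3) z(1)] comp_assoc[OF b1(2,3) z(1)]
        comp_assoc[OF b1(1,4) z(2)] comp_assoc[OF b1(2,4) z(2)]
        comp_assoc[OF z(1) b2(1,3)] comp_assoc[OF z(2) b2(2,3)]
        comp_assoc[OF z(1) b2(1,4)] comp_assoc[OF z(2) b2(2,4)]
      by (simp_all add: b1 b2 Z ident_comp[OF z(1)] ident_comp[OF z(2)] comp_ident[OF z(1)]
          comp_ident[OF z(2)] zero_comp[OF z(1)] zero_comp[OF z(2)] comp_zero[OF z(1)] comp_zero[OF z(2)])
    then show "p' \<cdot> Z = z \<cdot> p" "q' \<cdot> Z = z' \<cdot> q"
      using biproduct_eqI_copair[OF b] comp_mor[OF Z(1) b2(3)] comp_mor[OF Z(1) b2(4)]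
        comp_mor[OF b1(3) z(1)] comp_mor[OF b1(4) z(2)] by blast+
  qed
  note m = Tri_morD[OF t] and m' = Tri_morD[OF t']
  note A = biproductD[OF bA] and B = biproductD[OF bB] and C = biproductD[OF bC]
  note px = proj[OF bA bB m(1) m'(1) X] and py = proj[OF bB bC m(2) m'(2) Y]
  \<comment> \<open>The target of \<open>\<epsilon>\<close> is \<open>Sh SA\<close>, so
    \<open>proj\<close> applies to it only after the additive shift has been seen to preserve the
    biproduct.\<close>
  have bSh: "biproduct \<C> (Sh \<C> A) (Sh \<C> A') (Sh \<C> SA) (sh \<C> iA) (sh \<C> jA) (sh \<C> pA) (sh \<C> qA)"
    using A sh_mor sh_add[OF comp_mor[OF A(3,1)] comp_mor[OF A(4,2)]]
      sh_comp[OF A(1,3)] sh_comp[OF A(1,4)] sh_comp[OF A(2,3)] sh_comp[OF A(2,4)]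
      sh_comp[OF A(3,1)] sh_comp[OF A(4,2)]
    unfolding biproduct_def by (simp add: sh_ident)
  note p\<epsilon> = proj[OF bC bSh m(3) m'(3) \<epsilon>]
  obtain F N G where tN: "(SA, F, N, G, SC, \<epsilon>) \<in> Tri \<C>"
    using Tri_exists_third[OF \<epsilon>(1)] by blast
  note mN = Tri_morD[OF tN]
  obtain b1 where b1: "b1 \<in> mor \<C> B N" "b1 \<cdot> x = F \<cdot> iA" "G \<cdot> b1 = iC \<cdot> y"
    using Tri_morphism_middle[OF t tN A(1) C(1)] \<epsilon> by metis
  obtain b2 where b2: "b2 \<in> mor \<C> B' N" "b2 \<cdot> x' = F \<cdot> jA" "G \<cdot> b2 = jC \<cdot> y'"
    using Tri_morphism_middle[OF t' tN A(2) C(2)] \<epsilon> by metis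
  obtain c1 where c1: "c1 \<in> mor \<C> N B" "c1 \<cdot> F = x \<cdot> pA" "y \<cdot> c1 = pC \<cdot> G"
    using Tri_morphism_middle[OF tN t A(3) C(3)] p\<epsilon> by metis
  obtain c2 where c2: "c2 \<in> mor \<C> N B'" "c2 \<cdot> F = x' \<cdot> qA" "y' \<cdot> c2 = qC \<cdot> G"
    using Tri_morphism_middle[OF tN t' A(4) C(4)] p\<epsilon> by metis
  obtain c where c: "c \<in> mor \<C> N SB" "pB \<cdot> c = c1" "qB \<cdot> c = c2"
    using biproduct_pair[OF bB c1(1) c2(1)] by blast
  obtain b where b: "b \<in> mor \<C> SB N" "b \<cdot> iB = b1" "b \<cdot> jB = b2"
    using biproduct_copair[OF bB b1(1) b2(1)] by blast
  have cF: "c \<cdot> F = X"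
    using comp_assoc[OF mN(1) c(1) B(3)] comp_assoc[OF mN(1) c(1) B(4)] c c1 c2 px
    by (intro biproduct_eqI_pair[OF bB comp_mor[OF mN(1) c(1)] X(1)]) simp_all
  have Yc: "Y \<cdot> c = G"
    using comp_assoc[OF c(1) Y(1) C(3)] comp_assoc[OF c(1) Y(1) C(4)]
      comp_assoc[OF c(1) B(3) m(2)] comp_assoc[OF c(1) B(4) m'(2)] c c1 c2 py
    by (intro biproduct_eqI_pair[OF bC comp_mor[OF c(1) Y(1)] mN(2)]) simp_all
  have bX: "b \<cdot> X = F"
    using comp_assoc[OF A(1) X(1) b(1)] comp_assoc[OF A(2) X(1) b(1)]
      comp_assoc[OF m(1) B(1) b(1)] comp_assoc[OF m'(1) B(2) b(1)] b b1 b2 X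
    by (intro biproduct_eqI_copair[OF bA comp_mor[OF X(1) b(1)] mN(1)]) simp_all
  have Gb: "G \<cdot> b = Y"
    using comp_assoc[OF B(1) b(1) mN(2)] comp_assoc[OF B(2) b(1) mN(2)] b b1 b2 Y
    by (intro biproduct_eqI_copair[OF bB comp_mor[OF b(1) mN(2)] Y(1)]) simp_all
  \<comment> \<open>The kernel condition is checked componentwise: the projections of
    \<open>n\<close> lift through \<open>x\<close> and \<open>x'\<close>, and the two lifts are
    paired into \<open>w\<close>.\<close>
  have "\<exists>w\<in>mor \<C> SB SA. n = X \<cdot> w" if n: "n \<in> mor \<C> SB SB" "Y \<cdot> n = \<zero>\<^bsub>Hom \<C> SB SC\<^esub>" for n
  proof -
    have "y \<cdot> (pB \<cdot> n) = \<zero>\<^bsub>Hom \<C> SB C\<^esub>" "y' \<cdot> (qB \<cdot> n) = \<zero>\<^bsub>Hom \<C> SB C'\<^esub>"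
      using comp_assoc[OF n(1) B(3) m(2)] comp_assoc[OF n(1) B(4) m'(2)]
        comp_assoc[OF n(1) Y(1) C(3)] comp_assoc[OF n(1) Y(1) C(4)] n py
        comp_zero[OF C(3)] comp_zero[OF C(4)] by simp_all
    then obtain w1 w2 where w1: "w1 \<in> mor \<C> SB A" "pB \<cdot> n = x \<cdot> w1"
      and w2: "w2 \<in> mor \<C> SB A'" "qB \<cdot> n = x' \<cdot> w2"
      using Tri_lift[OF t comp_mor[OF n(1) B(3)]] Tri_lift[OF t' comp_mor[OF n(1) B(4)]] by blast
    obtain w where w: "w \<in> mor \<C> SB SA" "pA \<cdot> w = w1" "qA \<cdot> w = w2"
      using biproduct_pair[OF bA w1(1) w2(1)] by blast
    have "n = X \<cdot> w"
      using comp_assoc[OF w(1) X(1) B(3)] comp_assoc[OF w(1) X(1) B(4)]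
        comp_assoc[OF w(1) A(3) m(1)] comp_assoc[OF w(1) A(4) m'(1)] w w1 w2 px
      by (intro biproduct_eqI_pair[OF bB n(1) comp_mor[OF w(1) X(1)]]) simp_all
    then show ?thesis
      using w by blast
  qed
  from Tri_transfer(2)[OF tN X(1) Y(1) c(1) cF Yc b(1) bX Gb this] show ?thesis .
qed

text \<open>
  This is \<open>TR4\<close> for the rotated triangles. Rotating \<open>(D, d, E, e, F, \<delta> \<cdot> g')\<close> three times gives three
  minus signs but \<open>TR4\<close> only one; the isomorphism \<open>(1, -1, 1)\<close> removes the other two.
\<close>

lemma TR4_op:
  assumes t: "(D, f', A, f, B, \<delta>) \<in> Tri \<C>" and t': "(F, g', B, g, C, \<delta>') \<in> Tri \<C>"
    and t'': "(E, h', A, g \<cdot> f, C, \<delta>'') \<in> Tri \<C>"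
  shows "\<exists>d\<in>mor \<C> D E. \<exists>e\<in>mor \<C> E F.
    (D, d, E, e, F, \<delta> \<cdot> g') \<in> Tri \<C> \<and>
    h' \<cdot> d = f' \<and> f \<cdot> h' = g' \<cdot> e \<and> sh \<C> e \<cdot> \<delta>'' = \<delta>' \<and> sh \<C> d \<cdot> \<delta> = \<delta>'' \<cdot> g"
proof -
  note m = Tri_morD[OF t] and m' = Tri_morD[OF t'] and m'' = Tri_morD[OF t'']
  obtain d e where d: "d \<in> mor \<C> D E" and e: "e \<in> mor \<C> E F"
    and tt: "(Sh \<C> D, sh \<C> d, Sh \<C> E, sh \<C> e, Sh \<C> F,
        sh \<C> \<delta> \<cdot> (\<ominus>\<^bsub>Hom \<C> (Sh \<C> F) (Sh \<C> B)\<^esub> sh \<C> g')) \<in> Tri \<C>"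
    and eqs: "sh \<C> d \<cdot> \<delta> = \<delta>'' \<cdot> g" "sh \<C> e \<cdot> \<delta>'' = \<delta>'"
      "(\<ominus>\<^bsub>Hom \<C> (Sh \<C> E) (Sh \<C> A)\<^esub> sh \<C> h') \<cdot> sh \<C> d = \<ominus>\<^bsub>Hom \<C> (Sh \<C> D) (Sh \<C> A)\<^esub> sh \<C> f'"
      "(\<ominus>\<^bsub>Hom \<C> (Sh \<C> F) (Sh \<C> B)\<^esub> sh \<C> g') \<cdot> sh \<C> e =
       sh \<C> f \<cdot> (\<ominus>\<^bsub>Hom \<C> (Sh \<C> E) (Sh \<C> A)\<^esub> sh \<C> h')"
  proof -
    from TR4[OF Tri_rotate[OF t] Tri_rotate[OF t'] Tri_rotate[OF t'']] obtain d1 e1 where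
      d1: "d1 \<in> mor \<C> (Sh \<C> D) (Sh \<C> E)" and e1: "e1 \<in> mor \<C> (Sh \<C> E) (Sh \<C> F)" and
      *: "(Sh \<C> D, d1, Sh \<C> E, e1, Sh \<C> F,
        sh \<C> \<delta> \<cdot> (\<ominus>\<^bsub>Hom \<C> (Sh \<C> F) (Sh \<C> B)\<^esub> sh \<C> g')) \<in> Tri \<C>"
      "d1 \<cdot> \<delta> = \<delta>'' \<cdot> g" "e1 \<cdot> \<delta>'' = \<delta>'"
      "(\<ominus>\<^bsub>Hom \<C> (Sh \<C> E) (Sh \<C> A)\<^esub> sh \<C> h') \<cdot> d1 = \<ominus>\<^bsub>Hom \<C> (Sh \<C> D) (Sh \<C> A)\<^esub> sh \<C> f'"
      "(\<ominus>\<^bsub>Hom \<C> (Sh \<C> F) (Sh \<C> B)\<^esub> sh \<C> g') \<cdot> e1 =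
       sh \<C> f \<cdot> (\<ominus>\<^bsub>Hom \<C> (Sh \<C> E) (Sh \<C> A)\<^esub> sh \<C> h')"
      by blast
    obtain d where "d \<in> mor \<C> D E" "d1 = sh \<C> d"
      using d1 by (rule sh_full)
    moreover obtain e where "e \<in> mor \<C> E F" "e1 = sh \<C> e"
      using e1 by (rule sh_full)
    ultimately show ?thesis
      using that * by blast
  qed
  note s = sh_mor[OF m(1)] sh_mor[OF m(2)] sh_mor[OF m'(1)] sh_mor[OF m''(1)] sh_mor[OF d] sh_mor[OF e]
  have "\<ominus>\<^bsub>Hom \<C> (Sh \<C> D) (Sh \<C> A)\<^esub> sh \<C> (h' \<cdot> d) = \<ominus>\<^bsub>Hom \<C> (Sh \<C> D) (Sh \<C> A)\<^esub> sh \<C> f'"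
    using eqs(3) uminus_comp[OF s(5,4)] sh_comp[OF d m''(1)] by simp
  then have hd: "h' \<cdot> d = f'"
    using uminus_inject sh_inject sh_mor comp_mor[OF d m''(1)] m(1) by meson
  have "\<ominus>\<^bsub>Hom \<C> (Sh \<C> E) (Sh \<C> B)\<^esub> sh \<C> (f \<cdot> h') = \<ominus>\<^bsub>Hom \<C> (Sh \<C> E) (Sh \<C> B)\<^esub> sh \<C> (g' \<cdot> e)"
    using eqs(4) uminus_comp[OF s(6,3)] comp_uminus[OF s(4,2)] sh_comp[OF e m'(1)] sh_comp[OF m''(1) m(2)]
    by simp
  then have fh: "f \<cdot> h' = g' \<cdot> e"
    using uminus_inject sh_inject sh_mor comp_mor[OF e m'(1)] comp_mor[OF m''(1) m(2)] by meson
  let ?nd = "\<ominus>\<^bsub>Hom \<C> (Sh \<C> D) (Sh \<C> E)\<^esub> sh \<C> d"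
  let ?ne = "\<ominus>\<^bsub>Hom \<C> (Sh \<C> E) (Sh \<C> F)\<^esub> sh \<C> e"
  let ?n\<epsilon> = "\<ominus>\<^bsub>Hom \<C> (Sh \<C> F) (Sh \<C> (Sh \<C> D))\<^esub> sh \<C> (\<delta> \<cdot> g')"
  let ?i = "\<ominus>\<^bsub>Hom \<C> (Sh \<C> E) (Sh \<C> E)\<^esub> ident \<C> (Sh \<C> E)"
  have \<delta>g: "\<delta> \<cdot> g' \<in> mor \<C> F (Sh \<C> D)"
    using m m' comp_mor by blast
  have n: "?nd \<in> mor \<C> (Sh \<C> D) (Sh \<C> E)" "?ne \<in> mor \<C> (Sh \<C> E) (Sh \<C> F)"
    "?n\<epsilon> \<in> mor \<C> (Sh \<C> F) (Sh \<C> (Sh \<C> D))"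
    using s sh_mor[OF \<delta>g] by simp_all
  have i: "?i \<in> mor \<C> (Sh \<C> E) (Sh \<C> E)"
    using ident_mor by simp
  have "?i \<cdot> ?i = ident \<C> (Sh \<C> E)"
    using comp_uminus[OF ident_mor i] ident_mor[of "Sh \<C> E"] by (simp add: comp_ident[OF i] Hom.minus_minus)
  then have iso: "is_iso \<C> (Sh \<C> E) (Sh \<C> E) ?i"
    using i unfolding is_iso_def by blast
  have "(Sh \<C> D, ?nd, Sh \<C> E, ?ne, Sh \<C> F, ?n\<epsilon>) \<in> Tri \<C>"
  proof (rule TR1_iso[OF tt n is_iso_ident iso is_iso_ident])
    show "?i \<cdot> sh \<C> d = ?nd \<cdot> ident \<C> (Sh \<C> D)"
      using uminus_comp[OF s(5) ident_mor] by (simp add: comp_ident[OF n(1)] ident_comp[OF s(5)])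
    show "ident \<C> (Sh \<C> F) \<cdot> sh \<C> e = ?ne \<cdot> ?i"
      using comp_uminus[OF ident_mor n(2)] s(6)
      by (simp add: comp_ident[OF n(2)] ident_comp[OF s(6)] Hom.minus_minus)
    show "sh \<C> (ident \<C> (Sh \<C> D)) \<cdot> sh \<C> \<delta> \<cdot> (\<ominus>\<^bsub>Hom \<C> (Sh \<C> F) (Sh \<C> B)\<^esub> sh \<C> g') =
        ?n\<epsilon> \<cdot> ident \<C> (Sh \<C> F)"
      by (simp only: sh_ident comp_uminus[OF s(3) sh_mor[OF m(3)]] sh_comp[OF m'(1) m(3), symmetric]
          ident_comp[OF n(3)] comp_ident[OF n(3)])
  qed
  then have "(D, d, E, e, F, \<delta> \<cdot> g') \<in> Tri \<C>"
    using Tri_rotate3[OF d e \<delta>g] by blast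
  then show ?thesis
    using d e hd fh eqs by blast
qed

end

section \<open>Auslander-Reiten triangles and the relative extensions\<close>

context triangulated_category
begin

section \<open>Third morphisms of Auslander-Reiten triangles\<close>

text \<open>If \<open>\<eta>\<close> were zero, the triangle would split and make the sink morphism
  \<open>g\<close> a retraction.\<close>

lemma AR_triangle_third_nonzero:
  assumes ar: "AR_triangle \<C> N f E g X \<eta>"
  shows "\<eta> \<noteq> \<zero>\<^bsub>Hom \<C> X (Sh \<C> N)\<^esub>"
proof
  assume "\<eta> = \<zero>\<^bsub>Hom \<C> X (Sh \<C> N)\<^esub>"
  with ar have "(N, f, E, g, X, \<zero>\<^bsub>Hom \<C> X (Sh \<C> N)\<^esub>) \<in> Tri \<C>" "\<not> is_retraction \<C> E X g"
    unfolding AR_triangle_def sink_morphism_def by auto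
  then show False
    using Tri_split biproductD(2,4,6) unfolding is_retraction_def by metis
qed

text \<open>
  The cocone of a nonzero \<open>w\<close> is not a retraction, so it factors through the sink morphism of the
  Auslander-Reiten triangle; the induced morphism of triangles exhibits \<open>\<eta>\<close> as a multiple of \<open>w\<close>.
\<close>

lemma AR_third_factor_left:
  assumes ar: "AR_triangle \<C> N f E g X \<eta>"
    and w: "w \<in> mor \<C> X (Sh \<C> A)" "w \<noteq> \<zero>\<^bsub>Hom \<C> X (Sh \<C> A)\<^esub>"
  shows "\<exists>a\<in>mor \<C> A N. sh \<C> a \<cdot> w = \<eta>"
proof -
  have t: "(N, f, E, g, X, \<eta>) \<in> Tri \<C>" and g: "sink_morphism \<C> E X g"
    using ar unfolding AR_triangle_def by auto
  note m = Tri_morD[OF t]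
  obtain k M l where tw: "(A, k, M, l, X, w) \<in> Tri \<C>"
    using Tri_exists_third[OF w(1)] by blast
  note mw = Tri_morD[OF tw]
  have "\<not> is_retraction \<C> M X l"
  proof
    assume "is_retraction \<C> M X l"
    then obtain s where s: "s \<in> mor \<C> X M" "l \<cdot> s = ident \<C> X"
      unfolding is_retraction_def by blast
    then show False
      using comp_assoc[OF s(1) mw(2) w(1)] Tri_comp_zero[OF Tri_rotate[OF tw]] w
      by (simp add: comp_ident)
  qed
  then obtain b where b: "b \<in> mor \<C> M E" "l = g \<cdot> b"
    using g mw unfolding sink_morphism_def by blast
  then have "ident \<C> X \<cdot> l = g \<cdot> b"
    using ident_comp[OF mw(2)] by simp
  from Tri_morphism_first[OF tw t b(1) ident_mor this] show ?thesis
    using comp_ident[OF m(3)] by auto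
qed

text \<open>Since \<open>sh k \<cdot> w = 0\<close>, a nonzero \<open>w\<close> prevents
  \<open>k\<close> from being a section. So \<open>k\<close> factors through the source morphism,
  and TR3 with the identity of \<open>Y\<close> yields \<open>c\<close>.\<close>

lemma AR_third_factor_right:
  assumes ar: "AR_triangle \<C> Y f E g X \<eta>"
    and w: "w \<in> mor \<C> C (Sh \<C> Y)" "w \<noteq> \<zero>\<^bsub>Hom \<C> C (Sh \<C> Y)\<^esub>"
  shows "\<exists>c\<in>mor \<C> X C. w \<cdot> c = \<eta>"
proof -
  have t: "(Y, f, E, g, X, \<eta>) \<in> Tri \<C>" and f: "source_morphism \<C> Y E f"
    using ar unfolding AR_triangle_def by auto
  note m = Tri_morD[OF t]
  obtain k M l where tw: "(Y, k, M, l, C, w) \<in> Tri \<C>"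
    using Tri_exists_third[OF w(1)] by blast
  note mw = Tri_morD[OF tw]
  have "\<not> is_section \<C> Y M k"
  proof
    assume "is_section \<C> Y M k"
    then obtain r where r: "r \<in> mor \<C> M Y" "r \<cdot> k = ident \<C> Y"
      unfolding is_section_def by blast
    then have "sh \<C> r \<cdot> sh \<C> k = ident \<C> (Sh \<C> Y)"
      using sh_comp[OF mw(1) r(1)] by (simp add: sh_ident)
    then show False
      using comp_assoc[OF w(1) sh_mor[OF mw(1)] sh_mor[OF r(1)]] Tri_comp_zero_sh[OF tw] w
        comp_zero[OF sh_mor[OF r(1)], of C]
      by (simp add: ident_comp)
  qed
  then obtain b where b: "b \<in> mor \<C> E M" "k = b \<cdot> f"
    using f mw unfolding source_morphism_def by blast
  then have "b \<cdot> f = k \<cdot> ident \<C> Y"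
    using comp_ident[OF mw(1)] by simp
  from TR3[OF t tw ident_mor b(1) this] show ?thesis
    using ident_comp[OF m(3)] by (auto simp: sh_ident)
qed

text \<open>The criterion holds for each \<open>u\<close> separately: \<open>u\<close> extends along
  \<open>f\<close> exactly when \<open>sh u\<close> kills \<open>h\<close>, which is exactness of
  the triangle under morphisms into \<open>X\<close>.\<close>

lemma monic_wrt_iff:
  assumes t: "(A, f, B, g, C, h) \<in> Tri \<C>"
  shows "monic_wrt \<C> \<X> A B f \<longleftrightarrow> (\<forall>X\<in>\<X>. \<forall>u\<in>mor \<C> A X. sh \<C> u \<cdot> h = \<zero>\<^bsub>Hom \<C> C (Sh \<C> X)\<^esub>)"
proof -
  note m = Tri_morD[OF t]
  have "u \<in> (\<lambda>v. v \<cdot> f) ` mor \<C> B X \<longleftrightarrow> sh \<C> u \<cdot> h = \<zero>\<^bsub>Hom \<C> C (Sh \<C> X)\<^esub>" if u: "u \<in> mor \<C> A X" for X u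
  proof
    assume "u \<in> (\<lambda>v. v \<cdot> f) ` mor \<C> B X"
    then obtain v where v: "v \<in> mor \<C> B X" "u = v \<cdot> f"
      by blast
    then show "sh \<C> u \<cdot> h = \<zero>\<^bsub>Hom \<C> C (Sh \<C> X)\<^esub>"
      using comp_assoc[OF m(3) sh_mor[OF m(1)] sh_mor[OF v(1)]] sh_comp[OF m(1) v(1)]
        Tri_comp_zero_sh[OF t] comp_zero[OF sh_mor[OF v(1)], of C] by simp
  qed (use Tri_extend_sh[OF t u] in blast)
  moreover have "(\<lambda>v. v \<cdot> f) ` mor \<C> B X \<subseteq> mor \<C> A X" for X
    using m comp_mor by blast
  ultimately show ?thesis
    using m(1) unfolding monic_wrt_def by blast
qed

lemma epic_wrt_iff:
  assumes t: "(A, f, B, g, C, h) \<in> Tri \<C>"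
  shows "epic_wrt \<C> \<X> B C g \<longleftrightarrow> (\<forall>X\<in>\<X>. \<forall>v\<in>mor \<C> X C. h \<cdot> v = \<zero>\<^bsub>Hom \<C> X (Sh \<C> A)\<^esub>)"
proof -
  note m = Tri_morD[OF t]
  have "v \<in> (\<lambda>u. g \<cdot> u) ` mor \<C> X B \<longleftrightarrow> h \<cdot> v = \<zero>\<^bsub>Hom \<C> X (Sh \<C> A)\<^esub>" if v: "v \<in> mor \<C> X C" for X v
  proof
    assume "v \<in> (\<lambda>u. g \<cdot> u) ` mor \<C> X B"
    then obtain u where u: "u \<in> mor \<C> X B" "v = g \<cdot> u"
      by blast
    then show "h \<cdot> v = \<zero>\<^bsub>Hom \<C> X (Sh \<C> A)\<^esub>"
      using comp_assoc[OF u(1) m(2,3)] Tri_comp_zero[OF Tri_rotate[OF t]] zero_comp[OF u(1), of "Sh \<C> A"]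
      by simp
  qed (use Tri_lift[OF Tri_rotate[OF t] v] in blast)
  moreover have "(\<lambda>u. g \<cdot> u) ` mor \<C> X B \<subseteq> mor \<C> X C" for X
    using m comp_mor by blast
  ultimately show ?thesis
    using m(2) unfolding epic_wrt_def by blast
qed

end

section \<open>Monic and epic orthogonality for a tau-stable subcategory\<close>

locale tau_stable_subcategory = triangulated_category \<C>
  for \<C> :: "('k, 'o, 'm, 'x) tri_category_scheme" (structure) +
  fixes \<X> :: "'o set"
  assumes krull_schmidt: "krull_schmidt \<C>"
    and AR_translation: "has_AR_translation \<C>"
    and closed: "closed_subcategory \<C> \<X>"
    and functorially_finite: "functorially_finite \<C> \<X>"
    and tau_stable: "tau_image \<C> \<X> = \<X>"
begin

lemma summand_mem: "direct_sum \<C> n Xs S \<Longrightarrow> S \<in> \<X> \<Longrightarrow> a < n \<Longrightarrow> Xs a \<in> \<X>"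
  using closed unfolding closed_subcategory_def by blast

text \<open>Auslander-Reiten triangles exist for indecomposable objects, so \<open>X\<close> is
  decomposed first and \<open>\<delta> \<cdot> v\<close> is tested on each summand
  \<open>Xs a\<close>. The start \<open>N\<close> of the triangle ending in \<open>Xs a\<close> lies
  in \<open>tau_image\<close>, hence in \<open>\<X>\<close>, so \<open>orth\<close> applies to
  morphisms into it.\<close>

lemma monic_orthogonal_imp_epic_orthogonal:
  assumes \<delta>: "\<delta> \<in> mor \<C> C (Sh \<C> A)"
    and orth: "\<And>X u. X \<in> \<X> \<Longrightarrow> u \<in> mor \<C> A X \<Longrightarrow> sh \<C> u \<cdot> \<delta> = \<zero>\<^bsub>Hom \<C> C (Sh \<C> X)\<^esub>"
    and X: "X \<in> \<X>" and v: "v \<in> mor \<C> X C"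
  shows "\<delta> \<cdot> v = \<zero>\<^bsub>Hom \<C> X (Sh \<C> A)\<^esub>"
proof -
  obtain n Xs where ds: "direct_sum \<C> n Xs X" and loc: "\<And>a. a < n \<Longrightarrow> local_ring (End_ring \<C> (Xs a))"
    using krull_schmidt unfolding krull_schmidt_def by metis
  obtain i where i: "\<And>a. a < n \<Longrightarrow> i a \<in> mor \<C> (Xs a) X"
    and zero: "\<And>T v. v \<in> mor \<C> X T \<Longrightarrow> \<forall>a<n. v \<cdot> i a = \<zero>\<^bsub>Hom \<C> (Xs a) T\<^esub> \<Longrightarrow> v = \<zero>\<^bsub>Hom \<C> X T\<^esub>"
    using direct_sum_separated[OF ds] by blast
  have "(\<delta> \<cdot> v) \<cdot> i a = \<zero>\<^bsub>Hom \<C> (Xs a) (Sh \<C> A)\<^esub>" if a: "a < n" for a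
  proof (rule ccontr)
    assume ne: "(\<delta> \<cdot> v) \<cdot> i a \<noteq> \<zero>\<^bsub>Hom \<C> (Xs a) (Sh \<C> A)\<^esub>"
    have vi: "v \<cdot> i a \<in> mor \<C> (Xs a) C" and w: "(\<delta> \<cdot> v) \<cdot> i a \<in> mor \<C> (Xs a) (Sh \<C> A)"
      using i[OF a] v \<delta> comp_mor by blast+
    have ind: "indecomposable \<C> (Xs a)"
      using local_End_indecomposable loc a by blast
    then obtain N f E g \<eta> where ar: "AR_triangle \<C> N f E g (Xs a) \<eta>"
      using AR_translation unfolding has_AR_translation_def by blast
    have "is_tau \<C> (Xs a) N"
      unfolding is_tau_def
      by (rule exI[of _ 1], rule exI[of _ "\<lambda>_. Xs a"], rule exI[of _ "\<lambda>_. N"])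
        (use direct_sum_single ind ar in blast)
    then have N: "N \<in> \<X>"
      using tau_stable summand_mem[OF ds X a] unfolding tau_image_def by blast
    obtain u where u: "u \<in> mor \<C> A N" "sh \<C> u \<cdot> ((\<delta> \<cdot> v) \<cdot> i a) = \<eta>"
      using AR_third_factor_left[OF ar w ne] by blast
    have "(sh \<C> u \<cdot> \<delta>) \<cdot> (v \<cdot> i a) = \<eta>"
      using comp_assoc[OF vi \<delta> sh_mor[OF u(1)]] comp_assoc[OF i[OF a] v \<delta>] u(2) by simp
    then show False
      using orth[OF N u(1)] zero_comp[OF vi] AR_triangle_third_nonzero[OF ar] by simp
  qed
  then show ?thesis
    using zero comp_mor[OF v \<delta>] by blast
qed

text \<open>Here \<open>X\<close> is presented as a translate of some \<open>M\<close> in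
  \<open>\<X>\<close>. Each summand \<open>Ns a\<close> of \<open>X\<close> thereby starts an
  Auslander-Reiten triangle whose end \<open>Ms a\<close> is a summand of \<open>M\<close> and so
  belongs to \<open>\<X>\<close>, where \<open>orth\<close> applies.\<close>

lemma epic_orthogonal_imp_monic_orthogonal:
  assumes \<delta>: "\<delta> \<in> mor \<C> C (Sh \<C> A)"
    and orth: "\<And>X v. X \<in> \<X> \<Longrightarrow> v \<in> mor \<C> X C \<Longrightarrow> \<delta> \<cdot> v = \<zero>\<^bsub>Hom \<C> X (Sh \<C> A)\<^esub>"
    and X: "X \<in> \<X>" and u: "u \<in> mor \<C> A X"
  shows "sh \<C> u \<cdot> \<delta> = \<zero>\<^bsub>Hom \<C> C (Sh \<C> X)\<^esub>"
proof -
  have "X \<in> tau_image \<C> \<X>"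
    using X tau_stable by simp
  then obtain M where M: "M \<in> \<X>" and "is_tau \<C> M X"
    unfolding tau_image_def by blast
  then obtain n Ms Ns where ds: "direct_sum \<C> n Ms M" "direct_sum \<C> n Ns X"
    and ar: "\<And>a. a < n \<Longrightarrow> \<exists>f B g h. AR_triangle \<C> (Ns a) f B g (Ms a) h"
    unfolding is_tau_def by auto
  obtain p where p: "\<And>a. a < n \<Longrightarrow> p a \<in> mor \<C> X (Ns a)"
    and zero: "\<And>T u. u \<in> mor \<C> T X \<Longrightarrow> \<forall>a<n. p a \<cdot> u = \<zero>\<^bsub>Hom \<C> T (Ns a)\<^esub> \<Longrightarrow> u = \<zero>\<^bsub>Hom \<C> T X\<^esub>"
    using direct_sum_separated[OF ds(2)] by blast
  have comp0: "sh \<C> (p a \<cdot> u) \<cdot> \<delta> = \<zero>\<^bsub>Hom \<C> C (Sh \<C> (Ns a))\<^esub>" if a: "a < n" for a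
  proof (rule ccontr)
    assume ne: "sh \<C> (p a \<cdot> u) \<cdot> \<delta> \<noteq> \<zero>\<^bsub>Hom \<C> C (Sh \<C> (Ns a))\<^esub>"
    have pu: "p a \<cdot> u \<in> mor \<C> A (Ns a)"
      using p[OF a] u comp_mor by blast
    obtain f E g \<eta> where ar: "AR_triangle \<C> (Ns a) f E g (Ms a) \<eta>"
      using ar[OF a] by blast
    obtain c where c: "c \<in> mor \<C> (Ms a) C" "(sh \<C> (p a \<cdot> u) \<cdot> \<delta>) \<cdot> c = \<eta>"
      using AR_third_factor_right[OF ar comp_mor[OF \<delta> sh_mor[OF pu]] ne] by blast
    then show False
      using orth[OF summand_mem[OF ds(1) M a] c(1)] comp_assoc[OF c(1) \<delta> sh_mor[OF pu]]
        comp_zero[OF sh_mor[OF pu]] AR_triangle_third_nonzero[OF ar] by simp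
  qed
  \<comment> \<open>The projections \<open>p a\<close> detect morphisms into \<open>X\<close>, but
    \<open>sh u \<cdot> \<delta>\<close> ends in \<open>Sh X\<close>. Replacing its source
    \<open>C\<close> by an isomorphic \<open>Sh T\<close> makes it the shift of some
    \<open>w\<close> from \<open>T\<close> to \<open>X\<close>, to which the test applies.\<close>
  obtain T \<phi> where "is_iso \<C> (Sh \<C> T) C \<phi>"
    using Sh_essentially_surjective[of C] unfolding isomorphic_def by blast
  then obtain \<psi> where \<phi>: "\<phi> \<in> mor \<C> (Sh \<C> T) C" "\<psi> \<in> mor \<C> C (Sh \<C> T)" "\<phi> \<cdot> \<psi> = ident \<C> C"
    unfolding is_iso_def by blast
  have u\<delta>: "sh \<C> u \<cdot> \<delta> \<in> mor \<C> C (Sh \<C> X)"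
    using comp_mor[OF \<delta> sh_mor[OF u]] .
  obtain w where w: "w \<in> mor \<C> T X" "(sh \<C> u \<cdot> \<delta>) \<cdot> \<phi> = sh \<C> w"
    using sh_full[OF comp_mor[OF \<phi>(1) u\<delta>]] by blast
  have "p a \<cdot> w = \<zero>\<^bsub>Hom \<C> T (Ns a)\<^esub>" if a: "a < n" for a
  proof (rule sh_inject[OF comp_mor[OF w(1) p[OF a]] zero_mor])
    have "sh \<C> (p a \<cdot> w) = sh \<C> (p a) \<cdot> ((sh \<C> u \<cdot> \<delta>) \<cdot> \<phi>)"
      using sh_comp[OF w(1) p[OF a]] w(2) by simp
    also have "\<dots> = (sh \<C> (p a \<cdot> u) \<cdot> \<delta>) \<cdot> \<phi>"
      using comp_assoc[OF \<phi>(1) u\<delta> sh_mor[OF p[OF a]]] sh_comp[OF u p[OF a]]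
        comp_assoc[OF \<delta> sh_mor[OF u] sh_mor[OF p[OF a]]] by simp
    finally show "sh \<C> (p a \<cdot> w) = sh \<C> \<zero>\<^bsub>Hom \<C> T (Ns a)\<^esub>"
      using comp0[OF a] zero_comp[OF \<phi>(1)] by simp
  qed
  then have "(sh \<C> u \<cdot> \<delta>) \<cdot> \<phi> = \<zero>\<^bsub>Hom \<C> (Sh \<C> T) (Sh \<C> X)\<^esub>"
    using zero[OF w(1)] w(2) by simp
  then show ?thesis
    using comp_assoc[OF \<phi>(2,1) u\<delta>] zero_comp[OF \<phi>(2)] comp_ident[OF u\<delta>] \<phi>(3) by simp
qed

abbreviation \<E> where "\<E> \<equiv> rel_Ext \<C> \<X>"

lemma monic_iff_epic:
  assumes t: "(A, f, B, g, C, h) \<in> Tri \<C>"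
  shows "monic_wrt \<C> \<X> A B f \<longleftrightarrow> epic_wrt \<C> \<X> B C g"
proof
  note \<delta> = Tri_morD(3)[OF t]
  show "epic_wrt \<C> \<X> B C g" if "monic_wrt \<C> \<X> A B f"
    using that monic_orthogonal_imp_epic_orthogonal[OF \<delta>]
    unfolding monic_wrt_iff[OF t] epic_wrt_iff[OF t] by simp
  show "monic_wrt \<C> \<X> A B f" if "epic_wrt \<C> \<X> B C g"
    using that epic_orthogonal_imp_monic_orthogonal[OF \<delta>]
    unfolding monic_wrt_iff[OF t] epic_wrt_iff[OF t] by simp
qed

section \<open>The bifunctor of relative extensions\<close>

lemma rel_Ext_simps [simp]:
  "mult (Ext \<E> C A) = add (Hom \<C> C (Sh \<C> A))" "one (Ext \<E> C A) = \<zero>\<^bsub>Hom \<C> C (Sh \<C> A)\<^esub>"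
  "push \<E> a \<delta> = sh \<C> a \<cdot> \<delta>" "pull \<E> c \<delta> = \<delta> \<cdot> c"
  by (simp_all add: rel_Ext_def)

text \<open>Part (1) turns the existence of a suitable triangle into a linear condition on
  \<open>\<delta>\<close> alone. Sums, negatives and pushouts then satisfy it at once, and pullbacks
  along \<open>c\<close> do because \<open>c \<cdot> v\<close> is again a test morphism.\<close>

lemma mem_rel_Ext_iff:
  "\<delta> \<in> carrier (Ext \<E> C A) \<longleftrightarrow>
    \<delta> \<in> mor \<C> C (Sh \<C> A) \<and> (\<forall>X\<in>\<X>. \<forall>v\<in>mor \<C> X C. \<delta> \<cdot> v = \<zero>\<^bsub>Hom \<C> X (Sh \<C> A)\<^esub>)"
proof -
  have *: "monic_wrt \<C> \<X> A B f \<longleftrightarrow> (\<forall>X\<in>\<X>. \<forall>v\<in>mor \<C> X C. \<delta> \<cdot> v = \<zero>\<^bsub>Hom \<C> X (Sh \<C> A)\<^esub>)"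
    if "(A, f, B, g, C, \<delta>) \<in> Tri \<C>" for f B g
    using monic_iff_epic[OF that] epic_wrt_iff[OF that] by simp
  have "\<exists>f B g. (A, f, B, g, C, \<delta>) \<in> Tri \<C>" if "\<delta> \<in> mor \<C> C (Sh \<C> A)"
    using Tri_exists_third[OF that] by blast
  with * have "(\<exists>f B g. (A, f, B, g, C, \<delta>) \<in> Tri \<C> \<and> monic_wrt \<C> \<X> A B f) \<longleftrightarrow>
      (\<forall>X\<in>\<X>. \<forall>v\<in>mor \<C> X C. \<delta> \<cdot> v = \<zero>\<^bsub>Hom \<C> X (Sh \<C> A)\<^esub>)" if "\<delta> \<in> mor \<C> C (Sh \<C> A)"
    using that by blast
  then show ?thesis
    by (auto simp: rel_Ext_def)
qed

lemma E_triangle_iff: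
  "E_triangle \<E> (rel_real \<C>) A x B y C \<delta> \<longleftrightarrow> (A, x, B, y, C, \<delta>) \<in> Tri \<C> \<and> epic_wrt \<C> \<X> B C y"
proof (cases "(A, x, B, y, C, \<delta>) \<in> Tri \<C>")
  case t: True
  then show ?thesis
    using epic_wrt_iff[OF t] Tri_morD(3)[OF t] by (simp add: E_triangle_def rel_real_Tri mem_rel_Ext_iff)
qed (simp add: E_triangle_def rel_real_Tri)

text \<open>The second of two recognition criteria: in the octahedral axioms the composite triangle
  is recognised by its morphisms being \<open>\<X>\<close>-monic or \<open>\<X>\<close>-epic, the
  other one by its extension being a pushout or pullback.\<close>

lemma E_triangle_iff_mem:
  "(A, x, B, y, C, \<delta>) \<in> Tri \<C> \<Longrightarrow>
    E_triangle \<E> (rel_real \<C>) A x B y C \<delta> \<longleftrightarrow> \<delta> \<in> carrier (Ext \<E> C A)"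
  unfolding E_triangle_def rel_real_Tri by simp

lemma E_triangleD:
  assumes e: "E_triangle \<E> (rel_real \<C>) A x B y C \<delta>"
  shows "(A, x, B, y, C, \<delta>) \<in> Tri \<C>" "\<delta> \<in> carrier (Ext \<E> C A)"
    "monic_wrt \<C> \<X> A B x" "epic_wrt \<C> \<X> B C y"
proof -
  show t: "(A, x, B, y, C, \<delta>) \<in> Tri \<C>" and y: "epic_wrt \<C> \<X> B C y"
    using e E_triangle_iff by simp_all
  show "\<delta> \<in> carrier (Ext \<E> C A)"
    using e unfolding E_triangle_def by simp
  show "monic_wrt \<C> \<X> A B x"
    using monic_iff_epic[OF t] y by simp
qed

lemma rel_Ext_carrierD:
  assumes "\<delta> \<in> carrier (Ext \<E> C A)"
  shows "\<delta> \<in> mor \<C> C (Sh \<C> A)" "\<And>X v. X \<in> \<X> \<Longrightarrow> v \<in> mor \<C> X C \<Longrightarrow> \<delta> \<cdot> v = \<zero>\<^bsub>Hom \<C> X (Sh \<C> A)\<^esub>"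
  using assms unfolding mem_rel_Ext_iff by auto

lemma push_mem:
  assumes \<delta>: "\<delta> \<in> carrier (Ext \<E> C A)" and a: "a \<in> mor \<C> A A'"
  shows "sh \<C> a \<cdot> \<delta> \<in> carrier (Ext \<E> C A')"
  unfolding mem_rel_Ext_iff
proof (intro conjI ballI)
  note d = rel_Ext_carrierD[OF \<delta>]
  show "sh \<C> a \<cdot> \<delta> \<in> mor \<C> C (Sh \<C> A')"
    using comp_mor[OF d(1) sh_mor[OF a]] .
  show "(sh \<C> a \<cdot> \<delta>) \<cdot> v = \<zero>\<^bsub>Hom \<C> X (Sh \<C> A')\<^esub>" if "X \<in> \<X>" "v \<in> mor \<C> X C" for X v
    using comp_assoc[OF that(2) d(1) sh_mor[OF a]] d(2)[OF that] comp_zero[OF sh_mor[OF a]] by simp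
qed

lemma pull_mem:
  assumes \<delta>: "\<delta> \<in> carrier (Ext \<E> C A)" and c: "c \<in> mor \<C> C' C"
  shows "\<delta> \<cdot> c \<in> carrier (Ext \<E> C' A)"
  unfolding mem_rel_Ext_iff
proof (intro conjI ballI)
  note d = rel_Ext_carrierD[OF \<delta>]
  show "\<delta> \<cdot> c \<in> mor \<C> C' (Sh \<C> A)"
    using comp_mor[OF c d(1)] .
  show "(\<delta> \<cdot> c) \<cdot> v = \<zero>\<^bsub>Hom \<C> X (Sh \<C> A)\<^esub>" if "X \<in> \<X>" "v \<in> mor \<C> X C'" for X v
    using comp_assoc[OF that(2) c d(1)] d(2)[OF that(1) comp_mor[OF that(2) c]] by simp
qed

lemma add_mem:
  assumes "\<delta> \<in> carrier (Ext \<E> C A)" "\<delta>' \<in> carrier (Ext \<E> C A)"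
  shows "\<delta> \<oplus>\<^bsub>Hom \<C> C (Sh \<C> A)\<^esub> \<delta>' \<in> carrier (Ext \<E> C A)"
  unfolding mem_rel_Ext_iff
  using rel_Ext_carrierD[OF assms(1)] rel_Ext_carrierD[OF assms(2)] add_comp by simp

lemma uminus_mem:
  assumes "\<delta> \<in> carrier (Ext \<E> C A)"
  shows "\<ominus>\<^bsub>Hom \<C> C (Sh \<C> A)\<^esub> \<delta> \<in> carrier (Ext \<E> C A)"
  unfolding mem_rel_Ext_iff
  using rel_Ext_carrierD[OF assms] uminus_comp by simp

lemma zero_mem: "\<zero>\<^bsub>Hom \<C> C (Sh \<C> A)\<^esub> \<in> carrier (Ext \<E> C A)"
  unfolding mem_rel_Ext_iff by simp

lemma comm_group_rel_Ext: "comm_group (Ext \<E> C A)"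
proof (rule comm_groupI)
  note d = rel_Ext_carrierD(1)[of _ C A]
  show "\<exists>y\<in>carrier (Ext \<E> C A). y \<otimes>\<^bsub>Ext \<E> C A\<^esub> x = \<one>\<^bsub>Ext \<E> C A\<^esub>" if "x \<in> carrier (Ext \<E> C A)" for x
    using uminus_mem[OF that] Hom.l_neg[OF d[OF that]] by auto
qed (use rel_Ext_carrierD(1)[of _ C A] in \<open>auto simp: add_mem zero_mem Hom.a_assoc Hom.a_comm Hom.a_lcomm\<close>)

text \<open>The two \<open>hom\<close> conditions contain the assertion that the functoriality is
  well defined on relative extensions; the other laws are inherited from composition and the
  additive shift.\<close>

lemma biadditive_rel_Ext: "biadditive_functor \<C> \<E>"
proof (intro biadditive_functor.intro additive_category_axioms biadditive_functor_axioms.intro)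
  fix A A' A'' C C' C'' a a' c c' \<delta>
  show "comm_group (Ext \<E> C A)"
    by (rule comm_group_rel_Ext)
  show "push \<E> a \<in> hom (Ext \<E> C A) (Ext \<E> C A')" if a: "a \<in> mor \<C> A A'"
    using push_mem[OF _ a] comp_add[OF rel_Ext_carrierD(1) rel_Ext_carrierD(1) sh_mor[OF a]]
    by (intro homI) simp_all
  show "pull \<E> c \<in> hom (Ext \<E> C A) (Ext \<E> C' A)" if c: "c \<in> mor \<C> C' C"
    using pull_mem[OF _ c] add_comp[OF c rel_Ext_carrierD(1) rel_Ext_carrierD(1)]
    by (intro homI) simp_all
  assume "\<delta> \<in> carrier (Ext \<E> C A)"
  then have \<delta>: "\<delta> \<in> mor \<C> C (Sh \<C> A)"
    by (rule rel_Ext_carrierD)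
  show "push \<E> (ident \<C> A) \<delta> = \<delta>"
    by (simp add: sh_ident ident_comp[OF \<delta>])
  show "pull \<E> (ident \<C> C) \<delta> = \<delta>"
    by (simp add: comp_ident[OF \<delta>])
  show "push \<E> (a' \<cdot> a) \<delta> = push \<E> a' (push \<E> a \<delta>)" if "a \<in> mor \<C> A A'" "a' \<in> mor \<C> A' A''"
    using comp_assoc[OF \<delta> that[THEN sh_mor]] by (simp add: sh_comp[OF that])
  show "pull \<E> (c \<cdot> c') \<delta> = pull \<E> c' (pull \<E> c \<delta>)" if "c \<in> mor \<C> C' C" "c' \<in> mor \<C> C'' C'"
    using comp_assoc[OF that(2,1) \<delta>] by simp
  show "push \<E> a (pull \<E> c \<delta>) = pull \<E> c (push \<E> a \<delta>)" if "a \<in> mor \<C> A A'" "c \<in> mor \<C> C' C"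
    using comp_assoc[OF that(2) \<delta> sh_mor[OF that(1)]] by simp
  show "push \<E> (a \<oplus>\<^bsub>Hom \<C> A A'\<^esub> a') \<delta> = push \<E> a \<delta> \<otimes>\<^bsub>Ext \<E> C A'\<^esub> push \<E> a' \<delta>"
    if "a \<in> mor \<C> A A'" "a' \<in> mor \<C> A A'"
    using add_comp[OF \<delta> that[THEN sh_mor]] by (simp add: sh_add[OF that])
  show "pull \<E> (c \<oplus>\<^bsub>Hom \<C> C' C\<^esub> c') \<delta> = pull \<E> c \<delta> \<otimes>\<^bsub>Ext \<E> C' A\<^esub> pull \<E> c' \<delta>"
    if "c \<in> mor \<C> C' C" "c' \<in> mor \<C> C' C"
    using comp_add[OF that \<delta>] by simp
qed

section \<open>The realization and the extriangulated axioms\<close>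

lemma rel_real_seq_class:
  "(A, x, B, y, C, \<delta>) \<in> Tri \<C> \<Longrightarrow> rel_real \<C> C A \<delta> = seq_class \<C> A C (x, B, y)"
  by (simp only: rel_real_Tri seq_class_Tri)

lemma rel_real_sum:
  assumes e: "E_triangle \<E> (rel_real \<C>) A x B y C \<delta>" and e': "E_triangle \<E> (rel_real \<C>) A' x' B' y' C' \<delta>'"
    and bA: "biproduct \<C> A A' SA iA jA pA qA" and bB: "biproduct \<C> B B' SB iB jB pB qB"
    and bC: "biproduct \<C> C C' SC iC jC pC qC"
  shows "rel_real \<C> SC SA (push \<E> iA (pull \<E> pC \<delta>) \<otimes>\<^bsub>Ext \<E> SC SA\<^esub> push \<E> jA (pull \<E> qC \<delta>')) =
    seq_class \<C> SA SC
      (iB \<cdot> x \<cdot> pA \<oplus>\<^bsub>Hom \<C> SA SB\<^esub> jB \<cdot> x' \<cdot> qA, SB,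
       iC \<cdot> y \<cdot> pB \<oplus>\<^bsub>Hom \<C> SB SC\<^esub> jC \<cdot> y' \<cdot> qB)"
proof -
  note t = E_triangleD(1)[OF e] and t' = E_triangleD(1)[OF e']
  note m = Tri_morD[OF t] and m' = Tri_morD[OF t']
  note A = biproductD[OF bA] and B = biproductD[OF bB] and C = biproductD[OF bC]
  \<comment> \<open>Unfolding associativity brings the terms into the right-nested form that the
    axiom prescribes; for \<open>\<epsilon>\<close> it is the form of a pushout of a
    pullback.\<close>
  note X = biproduct_sum_comp[OF bA comp_mor[OF m(1) B(1)] comp_mor[OF m'(1) B(2)],
      unfolded comp_assoc[OF A(3) m(1) B(1)] comp_assoc[OF A(4) m'(1) B(2)]]
  note Y = biproduct_sum_comp[OF bB comp_mor[OF m(2) C(1)] comp_mor[OF m'(2) C(2)],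
      unfolded comp_assoc[OF B(3) m(2) C(1)] comp_assoc[OF B(4) m'(2) C(2)]]
  note \<epsilon> = biproduct_sum_comp[OF bC comp_mor[OF m(3) sh_mor[OF A(1)]] comp_mor[OF m'(3) sh_mor[OF A(2)]],
      unfolded comp_assoc[OF C(3) m(3) sh_mor[OF A(1)]] comp_assoc[OF C(4) m'(3) sh_mor[OF A(2)]]]
  show ?thesis
    using rel_real_seq_class[OF Tri_sum[OF t t' bA bB bC X Y \<epsilon>]] by simp
qed

lemma rel_ET4:
  assumes e: "E_triangle \<E> (rel_real \<C>) A f B f' D \<delta>" and e': "E_triangle \<E> (rel_real \<C>) B g C g' F \<delta>'"
  shows "\<exists>E. \<exists>h'\<in>mor \<C> C E. \<exists>d\<in>mor \<C> D E. \<exists>e\<in>mor \<C> E F. \<exists>\<delta>''.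
    h' \<cdot> g = d \<cdot> f' \<and> e \<cdot> h' = g' \<and>
    E_triangle \<E> (rel_real \<C>) A (g \<cdot> f) C h' E \<delta>'' \<and>
    E_triangle \<E> (rel_real \<C>) D d E e F (push \<E> f' \<delta>') \<and>
    pull \<E> d \<delta>'' = \<delta> \<and> push \<E> f \<delta>'' = pull \<E> e \<delta>'"
proof -
  note t = E_triangleD[OF e] and t' = E_triangleD[OF e']
  note m = Tri_morD[OF t(1)] and m' = Tri_morD[OF t'(1)]
  obtain E h' \<delta>'' where t'': "(A, g \<cdot> f, C, h', E, \<delta>'') \<in> Tri \<C>"
    using TR1_cone[OF comp_mor[OF m(1) m'(1)]] by blast
  obtain d e where de: "d \<in> mor \<C> D E" "e \<in> mor \<C> E F" "(D, d, E, e, F, sh \<C> f' \<cdot> \<delta>') \<in> Tri \<C>"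
    and eqs: "d \<cdot> f' = h' \<cdot> g" "e \<cdot> h' = g'" "\<delta>'' \<cdot> d = \<delta>" "\<delta>' \<cdot> e = sh \<C> f \<cdot> \<delta>''"
    using TR4[OF t(1) t'(1) t''] by blast
  have "E_triangle \<E> (rel_real \<C>) A (g \<cdot> f) C h' E \<delta>''"
    unfolding E_triangle_iff using t'' monic_wrt_comp[OF t(3) t'(3)] monic_iff_epic by blast
  moreover have "E_triangle \<E> (rel_real \<C>) D d E e F (push \<E> f' \<delta>')"
    using E_triangle_iff_mem[OF de(3)] push_mem[OF t'(2) m(2)] by simp
  ultimately show ?thesis
    using de(1,2) Tri_morD(2)[OF t''] eqs
    by (intro exI[of _ E] bexI[of _ h'] bexI[of _ d] bexI[of _ e] exI[of _ \<delta>'']) simp_all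
qed

text \<open>The composite is now formed by the second morphisms \<open>f\<close> and
  \<open>g\<close>, so its first morphism has to be supplied by \<open>Tri_exists_second\<close> and
  the epic criterion is the direct one.\<close>

lemma rel_ET4_op:
  assumes e: "E_triangle \<E> (rel_real \<C>) D f' A f B \<delta>" and e': "E_triangle \<E> (rel_real \<C>) F g' B g C \<delta>'"
  shows "\<exists>E. \<exists>d\<in>mor \<C> D E. \<exists>e\<in>mor \<C> E F. \<exists>h'\<in>mor \<C> E A. \<exists>\<delta>''.
    h' \<cdot> d = f' \<and> f \<cdot> h' = g' \<cdot> e \<and>
    E_triangle \<E> (rel_real \<C>) E h' A (g \<cdot> f) C \<delta>'' \<and>
    E_triangle \<E> (rel_real \<C>) D d E e F (pull \<E> g' \<delta>) \<and>
    push \<E> e \<delta>'' = \<delta>' \<and> push \<E> d \<delta> = pull \<E> g \<delta>''"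
proof -
  note t = E_triangleD[OF e] and t' = E_triangleD[OF e']
  note m = Tri_morD[OF t(1)] and m' = Tri_morD[OF t'(1)]
  obtain E h' \<delta>'' where t'': "(E, h', A, g \<cdot> f, C, \<delta>'') \<in> Tri \<C>"
    using Tri_exists_second[OF comp_mor[OF m(2) m'(2)]] by blast
  obtain d e where de: "d \<in> mor \<C> D E" "e \<in> mor \<C> E F" "(D, d, E, e, F, \<delta> \<cdot> g') \<in> Tri \<C>"
    and eqs: "h' \<cdot> d = f'" "f \<cdot> h' = g' \<cdot> e" "sh \<C> e \<cdot> \<delta>'' = \<delta>'" "sh \<C> d \<cdot> \<delta> = \<delta>'' \<cdot> g"
    using TR4_op[OF t(1) t'(1) t''] by blast
  have "E_triangle \<E> (rel_real \<C>) E h' A (g \<cdot> f) C \<delta>''"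
    unfolding E_triangle_iff using t'' epic_wrt_comp[OF t(4) t'(4)] by blast
  moreover have "E_triangle \<E> (rel_real \<C>) D d E e F (pull \<E> g' \<delta>)"
    using E_triangle_iff_mem[OF de(3)] pull_mem[OF t(2) m'(1)] by simp
  ultimately show ?thesis
    using de(1,2) Tri_morD(1)[OF t''] eqs
    by (intro exI[of _ E] bexI[of _ d] bexI[of _ e] bexI[of _ h'] exI[of _ \<delta>'']) simp_all
qed

lemma extriangulated_rel: "extriangulated_category \<C> \<E> (rel_real \<C>)"
proof (intro extriangulated_category.intro biadditive_rel_Ext extriangulated_category_axioms.intro)
  show "\<exists>x B y. x \<in> mor \<C> A B \<and> y \<in> mor \<C> B C \<and> rel_real \<C> C A \<delta> = seq_class \<C> A C (x, B, y)"
    if \<delta>: "\<delta> \<in> carrier (Ext \<E> C A)" for \<delta> C A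
  proof -
    obtain x B y where "(A, x, B, y, C, \<delta>) \<in> Tri \<C>"
      using Tri_exists_third[OF rel_Ext_carrierD(1)[OF \<delta>]] by blast
    from Tri_morD(1,2)[OF this] rel_real_seq_class[OF this] show ?thesis
      by (intro exI conjI)
  qed
next
  show "\<exists>b\<in>mor \<C> B B'. b \<cdot> x = x' \<cdot> a \<and> y' \<cdot> b = c \<cdot> y"
    if "E_triangle \<E> (rel_real \<C>) A x B y C \<delta>" "E_triangle \<E> (rel_real \<C>) A' x' B' y' C' \<delta>'"
      "a \<in> mor \<C> A A'" "c \<in> mor \<C> C C'" "push \<E> a \<delta> = pull \<E> c \<delta>'"
    for A x B y C \<delta> A' x' B' y' C' \<delta>' a c
    using Tri_morphism_middle[OF E_triangleD(1)[OF that(1)] E_triangleD(1)[OF that(2)] that(3,4)] that(5)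
    by simp
next
  show "rel_real \<C> C A \<one>\<^bsub>Ext \<E> C A\<^esub> = seq_class \<C> A C (i, S, q)"
    if "biproduct \<C> A C S i j p q" for A C S i j p q
    using rel_real_seq_class[OF Tri_biproduct[OF that]] by simp
next
  show "\<exists>c\<in>mor \<C> C C'. push \<E> a \<delta> = pull \<E> c \<delta>' \<and> c \<cdot> y = y' \<cdot> b"
    if "E_triangle \<E> (rel_real \<C>) A x B y C \<delta>" "E_triangle \<E> (rel_real \<C>) A' x' B' y' C' \<delta>'"
      "a \<in> mor \<C> A A'" "b \<in> mor \<C> B B'" "b \<cdot> x = x' \<cdot> a"
    for A x B y C \<delta> A' x' B' y' C' \<delta>' a b
    using TR3[OF E_triangleD(1)[OF that(1)] E_triangleD(1)[OF that(2)] that(3-5)] by auto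
next
  show "\<exists>a\<in>mor \<C> A A'. push \<E> a \<delta> = pull \<E> c \<delta>' \<and> b \<cdot> x = x' \<cdot> a"
    if "E_triangle \<E> (rel_real \<C>) A x B y C \<delta>" "E_triangle \<E> (rel_real \<C>) A' x' B' y' C' \<delta>'"
      "b \<in> mor \<C> B B'" "c \<in> mor \<C> C C'" "c \<cdot> y = y' \<cdot> b"
    for A x B y C \<delta> A' x' B' y' C' \<delta>' b c
    using Tri_morphism_first[OF E_triangleD(1)[OF that(1)] E_triangleD(1)[OF that(2)] that(3-5)] by simp
qed (rule rel_real_sum rel_ET4 rel_ET4_op; assumption)+

section \<open>Projectives, injectives and the Frobenius property\<close>

lemma projective_if_mem:
  assumes P: "P \<in> \<X>"
  shows "projective \<C> \<E> (rel_real \<C>) P"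
  unfolding projective_def
proof (intro allI impI ballI)
  fix A x B y C \<delta> u
  assume "E_triangle \<E> (rel_real \<C>) A x B y C \<delta>" and u: "u \<in> mor \<C> P C"
  then have "(\<lambda>v. y \<cdot> v) ` mor \<C> P B = mor \<C> P C"
    using E_triangleD(4) P unfolding epic_wrt_def by blast
  then show "\<exists>v\<in>mor \<C> P B. u = y \<cdot> v"
    using u by blast
qed

lemma injective_if_mem:
  assumes I: "I \<in> \<X>"
  shows "injective \<C> \<E> (rel_real \<C>) I"
  unfolding injective_def
proof (intro allI impI ballI)
  fix A x B y C \<delta> u
  assume "E_triangle \<E> (rel_real \<C>) A x B y C \<delta>" and u: "u \<in> mor \<C> A I"
  then have "(\<lambda>v. v \<cdot> x) ` mor \<C> B I = mor \<C> A I"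
    using E_triangleD(3) I unfolding monic_wrt_def by blast
  then show "\<exists>v\<in>mor \<C> B I. u = v \<cdot> x"
    using u by blast
qed

lemma E_triangle_right_approximation:
  obtains A x P y \<delta> where "E_triangle \<E> (rel_real \<C>) A x P y C \<delta>" "P \<in> \<X>"
proof -
  obtain P y where "right_approximation \<C> \<X> C P y"
    using functorially_finite unfolding functorially_finite_def by blast
  then have P: "P \<in> \<X>" "y \<in> mor \<C> P C"
    and appr: "\<And>Y u. Y \<in> \<X> \<Longrightarrow> u \<in> mor \<C> Y C \<Longrightarrow> \<exists>v\<in>mor \<C> Y P. u = y \<cdot> v"
    unfolding right_approximation_def by auto
  have "epic_wrt \<C> \<X> P C y"
    using P(2) appr comp_mor unfolding epic_wrt_def by blast
  moreover obtain A x \<delta> where "(A, x, P, y, C, \<delta>) \<in> Tri \<C>"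
    using Tri_exists_second[OF P(2)] by blast
  ultimately show ?thesis
    using P E_triangle_iff by (intro that) blast+
qed

text \<open>A left approximation is \<open>\<X>\<close>-monic by definition, whereas
  \<open>E_triangle_iff\<close> asks for an \<open>\<X>\<close>-epic second morphism; part (1) links
  the two.\<close>

lemma E_triangle_left_approximation:
  obtains x I y C \<delta> where "E_triangle \<E> (rel_real \<C>) A x I y C \<delta>" "I \<in> \<X>"
proof -
  obtain I x where "left_approximation \<C> \<X> A I x"
    using functorially_finite unfolding functorially_finite_def by blast
  then have I: "I \<in> \<X>" "x \<in> mor \<C> A I"
    and appr: "\<And>Y u. Y \<in> \<X> \<Longrightarrow> u \<in> mor \<C> A Y \<Longrightarrow> \<exists>v\<in>mor \<C> I Y. u = v \<cdot> x"
    unfolding left_approximation_def by auto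
  have "monic_wrt \<C> \<X> A I x"
    using I(2) appr comp_mor unfolding monic_wrt_def by blast
  moreover obtain y C \<delta> where "(A, x, I, y, C, \<delta>) \<in> Tri \<C>"
    using TR1_cone[OF I(2)] by blast
  ultimately show ?thesis
    using I E_triangle_iff monic_iff_epic by (intro that) blast+
qed

lemma Tri_split_mem:
  assumes t: "(A, f, B, g, C, \<delta>) \<in> Tri \<C>" and 0: "\<delta> = \<zero>\<^bsub>Hom \<C> C (Sh \<C> A)\<^esub>" and B: "B \<in> \<X>"
  shows "A \<in> \<X>" "C \<in> \<X>"
proof -
  obtain r s where "biproduct \<C> A C B f s r g"
    using Tri_split t 0 by metis
  from summand_mem[OF biproduct_imp_direct_sum[OF this] B, of 0]
    summand_mem[OF biproduct_imp_direct_sum[OF this] B, of 1]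
  show "A \<in> \<X>" "C \<in> \<X>"
    by simp_all
qed

lemma mem_if_projective:
  assumes "projective \<C> \<E> (rel_real \<C>) P"
  shows "P \<in> \<X>"
proof -
  obtain A x Q y \<delta> where e: "E_triangle \<E> (rel_real \<C>) A x Q y P \<delta>" and Q: "Q \<in> \<X>"
    by (rule E_triangle_right_approximation)
  note t = E_triangleD(1)[OF e]
  note m = Tri_morD[OF t]
  obtain s where s: "s \<in> mor \<C> P Q" "ident \<C> P = y \<cdot> s"
    using assms[unfolded projective_def, rule_format, OF e ident_mor] by blast
  \<comment> \<open>The identity of \<open>P\<close> is \<open>y \<cdot> s\<close>, so
    \<open>\<delta> = \<delta> \<cdot> y \<cdot> s\<close>, and
    \<open>\<delta> \<cdot> y = 0\<close>.\<close>
  have "\<delta> = \<zero>\<^bsub>Hom \<C> P (Sh \<C> A)\<^esub>"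
    using comp_assoc[OF s(1) m(2,3)] Tri_comp_zero[OF Tri_rotate[OF t]] zero_comp[OF s(1), of "Sh \<C> A"]
      comp_ident[OF m(3)] s(2) by simp
  then show ?thesis
    using Tri_split_mem(2)[OF t _ Q] by blast
qed

lemma mem_if_injective:
  assumes "injective \<C> \<E> (rel_real \<C>) I"
  shows "I \<in> \<X>"
proof -
  obtain x Q y C \<delta> where e: "E_triangle \<E> (rel_real \<C>) I x Q y C \<delta>" and Q: "Q \<in> \<X>"
    by (rule E_triangle_left_approximation[of I])
  note t = E_triangleD(1)[OF e]
  note m = Tri_morD[OF t]
  obtain r where r: "r \<in> mor \<C> Q I" "ident \<C> I = r \<cdot> x"
    using assms[unfolded injective_def, rule_format, OF e ident_mor] by blast
  \<comment> \<open>The retraction is shifted because \<open>\<delta>\<close> ends in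
    \<open>Sh I\<close>, and there \<open>sh x \<cdot> \<delta> = 0\<close> forces
    \<open>\<delta>\<close> to vanish.\<close>
  have "sh \<C> r \<cdot> sh \<C> x = ident \<C> (Sh \<C> I)"
    using sh_comp[OF m(1) r(1)] r(2) sh_ident[of I] by metis
  then have "\<delta> = \<zero>\<^bsub>Hom \<C> C (Sh \<C> I)\<^esub>"
    using comp_assoc[OF m(3) sh_mor[OF m(1)] sh_mor[OF r(1)]] Tri_comp_zero_sh[OF t]
      comp_zero[OF sh_mor[OF r(1)], of C] ident_comp[OF m(3)] by simp
  then show ?thesis
    using Tri_split_mem(1)[OF t _ Q] by blast
qed

lemma projective_iff_mem: "projective \<C> \<E> (rel_real \<C>) P \<longleftrightarrow> P \<in> \<X>"
  using projective_if_mem mem_if_projective by blast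

lemma injective_iff_mem: "injective \<C> \<E> (rel_real \<C>) I \<longleftrightarrow> I \<in> \<X>"
  using injective_if_mem mem_if_injective by blast

lemma frobenius_rel: "frobenius_extriangulated_category \<C> \<E> (rel_real \<C>)"
proof -
  have "\<exists>A x P y \<delta>. E_triangle \<E> (rel_real \<C>) A x P y C \<delta> \<and> P \<in> \<X>" for C
    by (rule E_triangle_right_approximation[of C]) blast
  moreover have "\<exists>x I y C \<delta>. E_triangle \<E> (rel_real \<C>) A x I y C \<delta> \<and> I \<in> \<X>" for A
    by (rule E_triangle_left_approximation[of A]) blast
  ultimately show ?thesis
    using extriangulated_rel
    by (simp add: frobenius_extriangulated_category_def enough_projectives_def
        enough_injectives_def projective_iff_mem injective_iff_mem)
qed

end

theorem corollary4p10:
  fixes K :: "('k, 'y) ring_scheme"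
    and \<C> :: "('k, 'o, 'm, 'x) tri_category_scheme"
    and \<X> :: "'o set"
  assumes "linear_category \<C> K"
    and "krull_schmidt \<C>"
    and "triangulated_category \<C>"
    and "has_AR_translation \<C>"
    and "closed_subcategory \<C> \<X>"
    and "functorially_finite \<C> \<X>"
    and "tau_image \<C> \<X> = \<X>"
  shows "(\<forall>A f B g C h. (A, f, B, g, C, h) \<in> Tri \<C> \<longrightarrow>
            (monic_wrt \<C> \<X> A B f \<longleftrightarrow> epic_wrt \<C> \<X> B C g))
       \<and> frobenius_extriangulated_category \<C> (rel_Ext \<C> \<X>) (rel_real \<C>)
       \<and> {P. projective \<C> (rel_Ext \<C> \<X>) (rel_real \<C>) P} = \<X>"
proof -
  interpret tau_stable_subcategory \<C> \<X>
    using assms by (intro tau_stable_subcategory.intro tau_stable_subcategory_axioms.intro)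
  show ?thesis
    using monic_iff_epic frobenius_rel projective_iff_mem by simp
qed

end
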